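(* Let $\mathrm{M}$ be a matroid of rank $r$ with lattice of flats $\mathcal{L}_{\mathrm{M}}$. Then: (1) The monomials $$\{h_{F_1}^{a_1} \dotsb h_{F_\ell}^{a_\ell} : \emptyset = F_0 < F_1 < \dotsb < F_\ell,\ a_1 \le \operatorname{rk}(F_1),\ a_i < \operatorname{rk}(F_i) - \operatorname{rk}(F_{i-1}) \text{ for } i=2, \dotsc, \ell\}$$ (with $\ell \ge 0$ and all $a_i \ge 1$) form a $\mathbb{Z}$-basis of $A^{\bullet}(\mathrm{M})$. (2) There is an isomorphism $\operatorname{deg} \colon A^{r}(\mathrm{M}) \to \mathbb{Z}$ such that for all nonempty flats $F_1, \dotsc, F_{r}$ (not necessarily distinct), $$\operatorname{deg}(h_{F_1} \dotsb h_{F_{r}}) = \begin{cases} 1 & \text{if } \operatorname{rk}(\bigvee_{i \in T} F_i) \ge |T| \text{ for all } T \subseteq [r], \\ 0 & \text{otherwise}.\end{cases}$$ (3) For each $k$, the pairing $A^k(\mathrm{M}) \times A^{r-k}(\mathrm{M}) \to \mathbb{Z}$, $(a,b) \mapsto \operatorname{deg}(ab)$, is unimodular, i.e., it induces an isomorphism $A^k(\mathrm{M}) \to \operatorname{Hom}(A^{r-k}(\mathrm{M}), \mathbb{Z})$.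
   Context: A matroid $\mathrm{M}$ is a finite nonempty atomic ranked lattice $\mathcal{L}_{\mathrm{M}}$ whose rank function $\operatorname{rk}$ is submodular: $\operatorname{rk}(F_1 \vee F_2) + \operatorname{rk}(F_1 \wedge F_2) \le \operatorname{rk}(F_1) + \operatorname{rk}(F_2)$. Atomic means every element is the join of the atoms below it; ranked means every maximal chain in $[\emptyset, F]$ has length $\operatorname{rk}(F)$. The elements are called flats, the minimal element is $\emptyset$, the maximal element is $E$, and the rank of $\mathrm{M}$ is $r = \operatorname{rk}(E)$. Let $\overline{\mathcal{L}}_{\mathrm{M}} = \mathcal{L}_{\mathrm{M}} \setminus \{\emptyset\}$. The augmented Chow ring is $$A^{\bullet}(\mathrm{M}) = \frac{\mathbb{Z}[h_F]_{F \in \overline{\mathcal{L}}_{\mathrm{M}}}}{((h_{F} - h_{G \vee F})(h_G - h_{G \vee F}) : F, G \in \overline{\mathcal{L}}_{\mathrm{M}}) + (h_a^2,\ h_ah_F - h_ah_{F \vee a} : F \in \overline{\mathcal{L}}_{\mathrm{M}},\ a \text{ an atom})},$$ graded with each $h_F$ in degree $1$. *)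

theory Defs
  imports "HOL-Algebra.Algebra" "HOL-Library.Poly_Mapping"
begin

section \<open>Matroids as lattices of flats\<close>

definition atom :: "'a::order_bot \<Rightarrow> bool" where
  "atom a \<longleftrightarrow> bot < a \<and> \<not> (\<exists>b. bot < b \<and> b < a)"

text \<open>
  The lattice of flats is carried by a type: a finite nonempty lattice is the same thing as a
  finite complete lattice, with \<^term>\<open>bot\<close> the empty flat and \<^term>\<open>Orderings.top\<close> the ground set \<open>E\<close>.
  A chain with \<open>n + 1\<close> elements has length \<open>n\<close>; as every interval \<open>[bot, F]\<close> has a maximal chain,
  \<open>rk\<close> is determined by the lattice.
\<close>

locale matroid_lattice =
  fixes rk :: "'a::{finite,complete_lattice} \<Rightarrow> nat"
  assumes atomic: "Sup {a. atom a \<and> a \<le> F} = F"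
    and ranked: "pred_on.maxchain {bot..F} (<) C \<Longrightarrow> card C = Suc (rk F)"
    and submodular: "rk (sup F G) + rk (inf F G) \<le> rk F + rk G"


section \<open>Integer polynomials in a given set of variables\<close>

text \<open>
  A monomial is an exponent vector \<open>'v \<Rightarrow>\<^sub>0 nat\<close>, and a polynomial is a finitely supported
  \<open>int\<close>-valued function on monomials, multiplied by convolution.
\<close>

type_synonym 'v int_mpoly = "('v \<Rightarrow>\<^sub>0 nat) \<Rightarrow>\<^sub>0 int"

definition mvar :: "'v \<Rightarrow> 'v int_mpoly" where
  "mvar v = Poly_Mapping.single (Poly_Mapping.single v 1) 1"

definition mpoly_ring :: "'v set \<Rightarrow> 'v int_mpoly ring" where
  "mpoly_ring V =
    \<lparr>carrier = {p. \<forall>m\<in>Poly_Mapping.keys p. Poly_Mapping.keys m \<subseteq> V},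
     monoid.mult = (*), one = 1, ring.zero = 0, add = (+)\<rparr>"

definition homogeneous :: "int \<Rightarrow> 'v int_mpoly \<Rightarrow> bool" where
  "homogeneous k p \<longleftrightarrow>
    (\<forall>m\<in>Poly_Mapping.keys p. int (\<Sum>v\<in>Poly_Mapping.keys m. Poly_Mapping.lookup m v) = k)"

lemma carrier_mpoly_ring_times:
  assumes "p \<in> carrier (mpoly_ring V)" "q \<in> carrier (mpoly_ring V)"
  shows "p * q \<in> carrier (mpoly_ring V)"
proof -
  have "Poly_Mapping.keys m \<subseteq> V" if m: "m \<in> Poly_Mapping.keys (p * q)" for m
  proof -
    obtain a b where "m = a + b" "a \<in> Poly_Mapping.keys p" "b \<in> Poly_Mapping.keys q"
      using m keys_mult[of p q] by auto
    then show ?thesis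
      using assms Poly_Mapping.keys_add[of a b] by (fastforce simp: mpoly_ring_def)
  qed
  then show ?thesis by (simp add: mpoly_ring_def)
qed

lemma cring_mpoly_ring: "cring (mpoly_ring V)"
proof (rule cringI)
  show "abelian_group (mpoly_ring V)"
  proof (rule abelian_groupI)
    fix p q assume "p \<in> carrier (mpoly_ring V)" "q \<in> carrier (mpoly_ring V)"
    then show "p \<oplus>\<^bsub>mpoly_ring V\<^esub> q \<in> carrier (mpoly_ring V)"
      using Poly_Mapping.keys_add[of p q] by (fastforce simp: mpoly_ring_def)
  next
    fix p assume p: "p \<in> carrier (mpoly_ring V)"
    then show "\<exists>q\<in>carrier (mpoly_ring V). q \<oplus>\<^bsub>mpoly_ring V\<^esub> p = \<zero>\<^bsub>mpoly_ring V\<^esub>"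
      by (intro bexI[of _ "- p"]) (auto simp: mpoly_ring_def)
  qed (auto simp: mpoly_ring_def)
  show "comm_monoid (mpoly_ring V)"
  proof (rule comm_monoidI)
    fix p q assume "p \<in> carrier (mpoly_ring V)" "q \<in> carrier (mpoly_ring V)"
    then show "p \<otimes>\<^bsub>mpoly_ring V\<^esub> q \<in> carrier (mpoly_ring V)"
      using carrier_mpoly_ring_times[of p V q] by (simp add: mpoly_ring_def)
  qed (auto simp: mpoly_ring_def mult_ac)
qed (auto simp: mpoly_ring_def algebra_simps)


section \<open>The augmented Chow ring\<close>

text \<open>
  It depends only on the lattice \<open>'a\<close>, so the constants below take \<open>'a\<close> as an \<open>itself\<close> argument
  where it is not otherwise visible.
\<close>

abbreviation flat_poly_ring :: "'a::{finite,complete_lattice} itself \<Rightarrow> 'a int_mpoly ring" where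
  "flat_poly_ring TYPE('a) \<equiv> mpoly_ring {F :: 'a. F \<noteq> bot}"

definition chow_ideal :: "'a::{finite,complete_lattice} itself \<Rightarrow> 'a int_mpoly set" where
  "chow_ideal TYPE('a) =
    Idl\<^bsub>flat_poly_ring TYPE('a)\<^esub>
      {(mvar F - mvar (sup G F)) * (mvar G - mvar (sup G F)) | F G :: 'a. F \<noteq> bot \<and> G \<noteq> bot}
    <+>\<^bsub>flat_poly_ring TYPE('a)\<^esub>
    Idl\<^bsub>flat_poly_ring TYPE('a)\<^esub>
      ({mvar a ^ 2 | a :: 'a. atom a} \<union>
       {mvar a * mvar F - mvar a * mvar (sup F a) | a F :: 'a. atom a \<and> F \<noteq> bot})"

definition aug_chow_ring :: "'a::{finite,complete_lattice} itself \<Rightarrow> 'a int_mpoly set ring" where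
  "aug_chow_ring TYPE('a) = flat_poly_ring TYPE('a) Quot chow_ideal TYPE('a)"

definition hcls :: "'a::{finite,complete_lattice} \<Rightarrow> 'a int_mpoly set" where
  "hcls F = chow_ideal TYPE('a) +>\<^bsub>flat_poly_ring TYPE('a)\<^esub> mvar F"

text \<open>The additive group of degree \<open>k\<close> classes, which is trivial for \<open>k < 0\<close>.\<close>

definition chow_part :: "'a::{finite,complete_lattice} itself \<Rightarrow> int \<Rightarrow> 'a int_mpoly set monoid" where
  "chow_part TYPE('a) k =
    \<lparr>carrier = {chow_ideal TYPE('a) +>\<^bsub>flat_poly_ring TYPE('a)\<^esub> p | p.
        p \<in> carrier (flat_poly_ring TYPE('a)) \<and> homogeneous k p},
     monoid.mult = add (aug_chow_ring TYPE('a)), one = \<zero>\<^bsub>aug_chow_ring TYPE('a)\<^esub>\<rparr>"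


section \<open>Bases and duals of abelian groups\<close>

text \<open>The family \<open>(b i)\<close>, \<open>i \<in> I\<close>, is a basis of the additive group of \<open>A\<close> as a \<open>\<int>\<close>-module.\<close>

definition int_basis :: "('a, 'm) ring_scheme \<Rightarrow> 'i set \<Rightarrow> ('i \<Rightarrow> 'a) \<Rightarrow> bool" where
  "int_basis A I b \<longleftrightarrow>
    b \<in> I \<rightarrow> carrier A \<and>
    (\<forall>x\<in>carrier A. \<exists>!c :: 'i \<Rightarrow>\<^sub>0 int.
      Poly_Mapping.keys c \<subseteq> I \<and>
      x = (\<Oplus>\<^bsub>A\<^esub>i\<in>Poly_Mapping.keys c. add_pow A (Poly_Mapping.lookup c i) (b i)))"

text \<open>
  \<^const>\<open>hom\<close> does not constrain the values outside the carrier, hence the restriction to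
  \<^const>\<open>extensional\<close> functions.
\<close>

definition Hom_group :: "('a, 'm) monoid_scheme \<Rightarrow> ('b, 'n) monoid_scheme \<Rightarrow> ('a \<Rightarrow> 'b) monoid" where
  "Hom_group G H =
    \<lparr>carrier = hom G H \<inter> extensional (carrier G),
     monoid.mult = (\<lambda>f g. \<lambda>x\<in>carrier G. f x \<otimes>\<^bsub>H\<^esub> g x),
     one = (\<lambda>x\<in>carrier G. \<one>\<^bsub>H\<^esub>)\<rparr>"


section \<open>The nested monomials\<close>

text \<open>
  The list \<open>[(F\<^sub>1, a\<^sub>1), \<dots>, (F\<^sub>l, a\<^sub>l)]\<close> stands for the monomial \<open>h_{F\<^sub>1}^{a\<^sub>1} \<dots> h_{F\<^sub>l}^{a\<^sub>l}\<close>;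
  list positions are one less than the indices of the \<open>F\<^sub>i\<close>.
\<close>

definition nested_data :: "('a::{finite,complete_lattice} \<Rightarrow> nat) \<Rightarrow> ('a \<times> nat) list set" where
  "nested_data rk = {xs.
     sorted_wrt (<) (bot # map fst xs) \<and>
     (\<forall>i<length xs. 1 \<le> snd (xs ! i)) \<and>
     (xs \<noteq> [] \<longrightarrow> snd (xs ! 0) \<le> rk (fst (xs ! 0))) \<and>
     (\<forall>i<length xs. 1 \<le> i \<longrightarrow> snd (xs ! i) < rk (fst (xs ! i)) - rk (fst (xs ! (i - 1))))}"

definition chow_monomial :: "('a::{finite,complete_lattice} \<times> nat) list \<Rightarrow> 'a int_mpoly set" where
  "chow_monomial xs =
    (\<Otimes>\<^bsub>aug_chow_ring TYPE('a)\<^esub>i\<in>{..<length xs}.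
      hcls (fst (xs ! i)) [^]\<^bsub>aug_chow_ring TYPE('a)\<^esub> snd (xs ! i))"


section \<open>Well-definedness\<close>

lemma mvar_in_carrier: "v \<in> V \<Longrightarrow> mvar v \<in> carrier (mpoly_ring V)"
  by (simp add: mvar_def mpoly_ring_def)

lemma minus_in_carrier:
  assumes "p \<in> carrier (mpoly_ring V)" "q \<in> carrier (mpoly_ring V)"
  shows "p - q \<in> carrier (mpoly_ring V)"
  using assms Poly_Mapping.keys_diff[of p q] by (fastforce simp: mpoly_ring_def)

lemma ideal_chow_ideal:
  "ideal (chow_ideal TYPE('a::{finite,complete_lattice})) (flat_poly_ring TYPE('a))"
proof -
  interpret R: cring "flat_poly_ring TYPE('a)" by (rule cring_mpoly_ring)
  have "atom a \<Longrightarrow> a \<noteq> bot" for a :: 'a by (auto simp: atom_def)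
  then show ?thesis
    unfolding chow_ideal_def
    by (intro R.add_ideals R.genideal_ideal) (auto intro!: mvar_in_carrier minus_in_carrier carrier_mpoly_ring_times
      simp: power2_eq_square)
qed

lemma cring_aug_chow_ring: "cring (aug_chow_ring TYPE('a::{finite,complete_lattice}))"
  unfolding aug_chow_ring_def
  by (rule ideal.quotient_is_cring[OF ideal_chow_ideal cring_mpoly_ring])

end

theory Submission
  imports Defs
begin

text \<open>
  Straightening: \<open>h_F h_G^d = h_G^(d+1)\<close> for \<open>F < G\<close> with \<open>d = rk G - rk F\<close>, and \<open>h_G\<close> to the power
  \<open>rk G + 1\<close> vanishes; together with the relation for incomparable \<open>F, G\<close> these rewrite every monomial
  towards larger flats, until only nested monomials remain.

  Degree: a monomial \<open>m\<close> of degree \<open>r\<close> satisfies the Hall--Rado condition iff, for every flat \<open>H\<close>,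
  the sum \<open>cum m H\<close> of its exponents on flats below \<open>H\<close> is at most \<open>rk H\<close>. In this form one sees by
  submodularity that the indicator function of the condition annihilates the ideal.

  Independence and duality: to a nested monomial \<open>n\<close> one assigns the function
  \<open>res n K = min {rk H - cum n H | H \<ge> K}\<close>, which determines \<open>n\<close>. For each nested \<open>f\<close> there is a polynomial \<open>y\<close>
  with \<open>deg (f y) = 1\<close> such that \<open>deg (n y) \<noteq> 0\<close> forces \<open>res n \<le> res f\<close> pointwise. So the pairing of
  nested monomials with these polynomials is unitriangular.
\<close>

section \<open>Rank functions\<close>

text \<open>Behind the constructions stands a picture: let each factor h_F be a point placed freely
  in the flat F. The bound \<open>cum m H\<close> <= \<open>rk H\<close> for all H says that the
  points of m are independent, degree 1 means that they form a basis, and for nested n the function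
  \<open>res n\<close> is the rank function that remains after contracting the points of n. The
  obstacle is that the ring is given by relations only: straightening bounds it from above, but that
  nothing more collapses can be seen only through functionals killing the ideal. The only ones used
  are \<open>degf\<close> and its composites with multiplication by a polynomial. That the diagonal
  entries are 1, and not merely nonzero, gives unimodularity: the triangular system is solvable
  without division. The same system yields independence when read from a least element of a support,
  and surjectivity of the pairing when solved for prescribed values. Each y lives in the
  complementary degree, so one construction serves every k; injectivity in (2) is the case k = r,
  where the complementary degree consists of integers.\<close>

definition covers :: "'a::order \<Rightarrow> 'a \<Rightarrow> bool" where
  "covers G F \<longleftrightarrow> F < G \<and> \<not> (\<exists>H. F < H \<and> H < G)"

lemma exists_covered:
  fixes F G :: "'a::{finite,order}"
  assumes "F < G"
  obtains H where "F \<le> H" "covers G H"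
proof -
  have "finite {H. F \<le> H \<and> H < G}" "{H. F \<le> H \<and> H < G} \<noteq> {}"
    using assms by auto
  then obtain H where "H \<in> {H. F \<le> H \<and> H < G}"
    "\<forall>K\<in>{H. F \<le> H \<and> H < G}. H \<le> K \<longrightarrow> H = K"
    using finite_has_maximal by metis
  then have "F \<le> H" "covers G H" unfolding covers_def
    by (auto, metis dual_order.strict_trans1 less_le)
  then show ?thesis by (rule that)
qed

context matroid_lattice
begin

lemma rk_bot [simp]: "rk bot = 0"
proof -
  have "pred_on.maxchain {bot..bot::'a} (<) {bot}"
    by (auto simp: pred_on.maxchain_def pred_on.chain_def)
  from ranked[OF this] show ?thesis by simp
qed

text \<open>\<open>ranked\<close> speaks only of maximal chains. A maximal chain of the interval up
  to F contains F, and adjoining G keeps it maximal: any further element is comparable to F but not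
  strictly between F and G, so it would already refine the old chain.\<close>

lemma rk_covers:
  assumes "covers G F"
  shows "rk G = Suc (rk F)"
proof -
  have FG: "F < G" and no: "\<And>H. F < H \<Longrightarrow> H < G \<Longrightarrow> False"
    using assms by (auto simp: covers_def)
  obtain C where C: "pred_on.maxchain {bot..F} (<) C" using pred_on.Hausdorff by blast
  have Csub: "C \<subseteq> {bot..F}"
    using C unfolding pred_on.maxchain_def pred_on.chain_def by (elim conjE)
  have Ctot: "x < y \<or> x = y \<or> y < x" if "x \<in> C" "y \<in> C" for x y
    using pred_on.chain_total[OF pred_on.maxchain_imp_chain[OF C] that] by blast
  have Cmax: "\<exists>x\<in>S. \<exists>y\<in>S. \<not> (x < y \<or> x = y \<or> y < x)" if "S \<subseteq> {bot..F}" "C \<subset> S" for S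
  proof (rule ccontr)
    assume "\<not> ?thesis"
    then have "pred_on.chain {bot..F} (<) S" using that(1) by (intro pred_on.chainI) blast+
    with C that(2) show False unfolding pred_on.maxchain_def by blast
  qed
  have FC: "F \<in> C"
  proof (rule ccontr)
    assume F: "F \<notin> C"
    have "x < F" if "x \<in> C" for x using that Csub F by (auto simp: less_le)
    moreover have "\<exists>x\<in>insert F C. \<exists>y\<in>insert F C. \<not> (x < y \<or> x = y \<or> y < x)"
      using Csub F by (intro Cmax) auto
    ultimately show False using Ctot by blast
  qed
  have GC: "G \<notin> C" using Csub FG by auto
  have Gmax: "x < G" if "x \<in> C" for x using that Csub FG by auto
  have "pred_on.maxchain {bot..G} (<) (insert G C)"
    unfolding pred_on.maxchain_def
  proof (intro conjI notI)
    show "pred_on.chain {bot..G} (<) (insert G C)"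
    proof (rule pred_on.chainI)
      show "insert G C \<subseteq> {bot..G}" using less_imp_le[OF Gmax] by auto
      show "(<)\<^sup>=\<^sup>= x y \<or> (<)\<^sup>=\<^sup>= y x" if "x \<in> insert G C" "y \<in> insert G C" for x y
        using that Gmax Ctot[of x y] by blast
    qed
    assume "\<exists>S. pred_on.chain {bot..G} (<) S \<and> insert G C \<subset> S"
    then obtain S where chain: "pred_on.chain {bot..G} (<) S" and S2: "insert G C \<subset> S" by blast
    have S1: "S \<subseteq> {bot..G}" using chain unfolding pred_on.chain_def by blast
    have tot: "x < y \<or> x = y \<or> y < x" if "x \<in> S" "y \<in> S" for x y
      using pred_on.chain_total[OF chain that] by blast
    obtain z where z: "z \<in> S" "z \<notin> C" "z \<noteq> G" using S2 by auto
    have "z \<le> F"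
    proof -
      have "z < G" using z S1 by (auto simp: less_le)
      moreover have "F \<in> S" using FC S2 by auto
      ultimately show ?thesis using tot[OF z(1), of F] no[of z] by auto
    qed
    then have "insert z C \<subseteq> {bot..F}" "C \<subset> insert z C" using Csub z by auto
    then show False using Cmax[OF \<open>insert z C \<subseteq> {bot..F}\<close>] tot z(1) S2 by blast
  qed
  from ranked[OF this] ranked[OF C] GC show ?thesis by simp
qed

lemma rk_strict_mono: "F < G \<Longrightarrow> rk F < rk G"
proof (induction "card {..<G}" arbitrary: G rule: less_induct)
  case less
  obtain H where H: "F \<le> H" "covers G H" using exists_covered[OF less.prems] .
  have "card {..<H} < card {..<G}"
    using H(2) by (intro psubset_card_mono) (auto simp: covers_def)
  then have "rk F \<le> rk H" using less.hyps H(1) by (cases "F = H") (auto simp: less_le)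
  with rk_covers[OF H(2)] show ?case by simp
qed

lemma rk_mono: "F \<le> G \<Longrightarrow> rk F \<le> rk G"
  using rk_strict_mono[of F G] by (cases "F = G") (auto simp: less_le)

text \<open>This is where \<open>atomic\<close> enters: if every atom below G were below F, then G,
  their join, would be below F.\<close>

lemma exists_atom_sup:
  fixes F G :: 'a
  assumes "covers G F"
  obtains a where "atom a" "sup F a = G"
proof -
  have FG: "F < G" and no: "\<And>H. F < H \<Longrightarrow> H < G \<Longrightarrow> False"
    using assms by (auto simp: covers_def)
  have "\<exists>a. atom a \<and> a \<le> G \<and> \<not> a \<le> F"
  proof (rule ccontr)
    assume "\<not> ?thesis"
    then have "Sup {a. atom a \<and> a \<le> G} \<le> F" by (intro Sup_least) auto
    with atomic[of G] FG show False by simp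
  qed
  then obtain a where a: "atom a" "a \<le> G" "\<not> a \<le> F" by blast
  have "F < sup F a" using a(3) by (metis sup.cobounded1 sup.cobounded2 less_le)
  moreover have "sup F a \<le> G" using a(2) FG by simp
  ultimately have "sup F a = G" using no[of "sup F a"] by (auto simp: less_le)
  with a(1) show ?thesis by (rule that)
qed

lemma rk_atom:
  assumes "atom a"
  shows "rk a = 1"
proof -
  have "covers a bot" using assms by (auto simp: covers_def atom_def)
  then show ?thesis using rk_covers[of a bot] by simp
qed

lemma rk_sup_atom_le: "atom a \<Longrightarrow> rk (sup F a) \<le> Suc (rk F)"
  using submodular[of F a] rk_atom[of a] by simp

lemma rk_eq_1_atom:
  assumes "rk F = 1"
  shows "atom F"
proof -
  have "bot < F" using assms bot.not_eq_extremum[of F] by auto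
  moreover have False if "bot < H" "H < F" for H
    using rk_strict_mono[OF that(1)] rk_strict_mono[OF that(2)] assms by simp
  ultimately show ?thesis by (auto simp: atom_def)
qed

lemma eq_bot_iff_rk: "F = bot \<longleftrightarrow> rk F = 0"
  using rk_strict_mono[of bot F] bot.not_eq_extremum[of F] by auto

end

section \<open>Exponent vectors\<close>

definition cum :: "('a::{finite,order} \<Rightarrow>\<^sub>0 nat) \<Rightarrow> 'a \<Rightarrow> nat" where
  "cum m H = (\<Sum>F | F \<le> H. Poly_Mapping.lookup m F)"

lemma cum_add: "cum (m + n) H = cum m H + cum n H"
  by (simp add: cum_def lookup_add sum.distrib)

lemma cum_0 [simp]: "cum 0 H = 0"
  by (simp add: cum_def)

lemma cum_single: "cum (Poly_Mapping.single F a) H = (if F \<le> H then a else 0)"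
  by (auto simp: cum_def lookup_single when_def)

lemma cum_mono: "H \<le> K \<Longrightarrow> cum m H \<le> cum m K"
  unfolding cum_def by (rule sum_mono2) auto

lemma lookup_le_cum: "Poly_Mapping.lookup m F \<le> cum m F"
  unfolding cum_def by (rule member_le_sum) auto

lemma cum_supermodular:
  fixes m :: "'a::{finite,lattice} \<Rightarrow>\<^sub>0 nat"
  shows "cum m F + cum m G \<le> cum m (sup F G) + cum m (inf F G)"
proof -
  have "cum m F + cum m G =
      (\<Sum>Y\<in>{Y. Y \<le> F} \<union> {Y. Y \<le> G}. Poly_Mapping.lookup m Y) + (\<Sum>Y\<in>{Y. Y \<le> F} \<inter> {Y. Y \<le> G}. Poly_Mapping.lookup m Y)"
    unfolding cum_def by (rule sum.union_inter[symmetric]) auto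
  also have "(\<Sum>Y\<in>{Y. Y \<le> F} \<inter> {Y. Y \<le> G}. Poly_Mapping.lookup m Y) = cum m (inf F G)"
    unfolding cum_def by (rule sum.cong) auto
  also have "(\<Sum>Y\<in>{Y. Y \<le> F} \<union> {Y. Y \<le> G}. Poly_Mapping.lookup m Y) \<le> cum m (sup F G)"
    unfolding cum_def by (rule sum_mono2) (auto intro: le_supI1 le_supI2)
  finally show ?thesis by simp
qed

lemma cum_top: "cum m (Orderings.top :: 'a::{finite,order_top}) = (\<Sum>F\<in>UNIV. Poly_Mapping.lookup m F)"
  by (simp add: cum_def)

lemma cum_top_keys:
  "cum m (Orderings.top :: 'a::{finite,order_top}) = (\<Sum>F\<in>Poly_Mapping.keys m. Poly_Mapping.lookup m F)"
  unfolding cum_top by (rule sum.mono_neutral_right) (auto simp: in_keys_iff)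

lemma exponent_induct [case_names zero step]:
  fixes m :: "'a::finite \<Rightarrow>\<^sub>0 nat"
  assumes "P 0" and "\<And>m F. P m \<Longrightarrow> P (Poly_Mapping.single F 1 + m)"
  shows "P m"
proof (induction "\<Sum>F\<in>UNIV. Poly_Mapping.lookup m F" arbitrary: m)
  case 0
  then have "m = 0" by (intro poly_mapping_eqI) simp
  with assms(1) show ?case by simp
next
  case (Suc k)
  then obtain F where F: "Poly_Mapping.lookup m F \<noteq> 0"
    by (metis (no_types, lifting) nat.distinct(1) sum.neutral)
  have m: "m = Poly_Mapping.single F 1 + (m - Poly_Mapping.single F 1)"
    using F by (intro poly_mapping_eqI) (auto simp: lookup_add lookup_minus lookup_single when_def)
  have "Suc k = 1 + (\<Sum>Y\<in>UNIV. Poly_Mapping.lookup (m - Poly_Mapping.single F 1) Y)"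
    unfolding Suc.hyps(2) by (subst m) (simp add: lookup_add sum.distrib lookup_single when_def)
  then have "P (m - Poly_Mapping.single F 1)" by (intro Suc.hyps(1)) simp
  then show ?case by (subst m) (rule assms(2))
qed

lemma finite_bounded_exponents: "finite {m :: 'a::finite \<Rightarrow>\<^sub>0 nat. \<forall>F. Poly_Mapping.lookup m F \<le> b}"
proof -
  have "finite {g. \<forall>F. (F \<in> (UNIV :: 'a set) \<longrightarrow> g F \<in> {..b}) \<and> (F \<notin> UNIV \<longrightarrow> g F = 0)}"
    by (rule finite_set_of_finite_funs) auto
  moreover have "Poly_Mapping.lookup ` {m :: 'a \<Rightarrow>\<^sub>0 nat. \<forall>F. Poly_Mapping.lookup m F \<le> b} \<subseteq>
      {g. \<forall>F. (F \<in> UNIV \<longrightarrow> g F \<in> {..b}) \<and> (F \<notin> UNIV \<longrightarrow> g F = 0)}"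
    by auto
  ultimately have "finite (Poly_Mapping.lookup ` {m :: 'a \<Rightarrow>\<^sub>0 nat. \<forall>F. Poly_Mapping.lookup m F \<le> b})"
    by (rule rev_finite_subset)
  then show ?thesis by (rule finite_imageD) (rule inj_onI, simp add: lookup_inject)
qed

section \<open>Monomials and coefficients\<close>

abbreviation mon :: "('v \<Rightarrow>\<^sub>0 nat) \<Rightarrow> 'v int_mpoly" where
  "mon m \<equiv> Poly_Mapping.single m 1"

lemma mvar_power: "mvar F ^ k = mon (Poly_Mapping.single F k)"
  by (induction k) (simp_all add: mvar_def mult_single single_add[symmetric])

lemma sum_monomials: "p = (\<Sum>m\<in>Poly_Mapping.keys p. Poly_Mapping.single m (Poly_Mapping.lookup p m))"
proof (rule poly_mapping_eqI)
  fix k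
  have "(\<Sum>m\<in>Poly_Mapping.keys p. Poly_Mapping.lookup (Poly_Mapping.single m (Poly_Mapping.lookup p m)) k)
      = (\<Sum>m\<in>Poly_Mapping.keys p. if m = k then Poly_Mapping.lookup p k else 0)"
    by (intro sum.cong) (auto simp: lookup_single when_def)
  then show "Poly_Mapping.lookup p k = Poly_Mapping.lookup (\<Sum>m\<in>Poly_Mapping.keys p. Poly_Mapping.single m (Poly_Mapping.lookup p m)) k"
    by (simp add: lookup_sum in_keys_iff)
qed

lemma single_of_int_mult: "Poly_Mapping.single m (c::int) = of_int c * mon m"
  by (subst single_of_int[symmetric]) (simp add: mult_single)

section \<open>Cumulative sums along chains\<close>

lemma chain_has_greatest:
  fixes S :: "'a::order set"
  assumes "finite S" "S \<noteq> {}" and chain: "\<And>A B. A \<in> S \<Longrightarrow> B \<in> S \<Longrightarrow> A \<le> B \<or> B \<le> A"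
  obtains A where "A \<in> S" "\<And>B. B \<in> S \<Longrightarrow> B \<le> A"
proof -
  obtain A where "A \<in> S" "\<forall>B\<in>S. A \<le> B \<longrightarrow> A = B"
    using finite_has_maximal[OF assms(1,2)] by blast
  with chain that show ?thesis by metis
qed

lemma cum_eq_0_iff: "cum m H = 0 \<longleftrightarrow> (\<forall>F\<in>Poly_Mapping.keys m. \<not> F \<le> H)"
  by (auto simp: cum_def in_keys_iff)

text \<open>Reduces \<open>cum\<close> at an arbitrary flat to its value on a chain containing the
  support. C may be larger than the support, so that one chain serves several exponent vectors at
  once.\<close>

lemma cum_eq_greatest:
  assumes "Poly_Mapping.keys m \<subseteq> C" "A \<le> H" "\<And>B. B \<in> C \<Longrightarrow> B \<le> H \<Longrightarrow> B \<le> A"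
  shows "cum m H = cum m A"
proof (rule antisym)
  have "cum m H = (\<Sum>F | F \<le> H \<and> F \<in> Poly_Mapping.keys m. Poly_Mapping.lookup m F)"
    unfolding cum_def by (rule sum.mono_neutral_right) (auto simp: in_keys_iff)
  also have "\<dots> \<le> cum m A"
    unfolding cum_def using assms by (intro sum_mono2) auto
  finally show "cum m H \<le> cum m A" .
qed (rule cum_mono[OF assms(2)])

lemma cum_less:
  assumes "A < B"
  shows "cum m A + Poly_Mapping.lookup m B \<le> cum m B"
proof -
  have "cum m A + Poly_Mapping.lookup m B = (\<Sum>F\<in>insert B {F. F \<le> A}. Poly_Mapping.lookup m F)"
    using assms by (subst sum.insert) (auto simp: cum_def)
  also have "\<dots> \<le> cum m B"
    unfolding cum_def using assms by (intro sum_mono2) auto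
  finally show ?thesis .
qed

lemma cum_split: "cum m B = Poly_Mapping.lookup m B + (\<Sum>F | F < B. Poly_Mapping.lookup m F)"
proof -
  have "{F. F \<le> B} = insert B {F. F < B}" by auto
  then show ?thesis by (simp add: cum_def)
qed

text \<open>The exponents along a chain are the successive differences of the cumulative sums, so
  every weakly increasing function occurs. The induction removes the greatest flat because an
  exponent placed there is invisible to \<open>cum\<close> at the smaller ones.\<close>

lemma exists_exponent_of_cum:
  fixes C :: "'a::{finite,order} set"
  assumes "\<And>A B. A \<in> C \<Longrightarrow> B \<in> C \<Longrightarrow> A \<le> B \<or> B \<le> A"
    and "\<And>A B. A \<in> C \<Longrightarrow> B \<in> C \<Longrightarrow> A \<le> B \<Longrightarrow> \<phi> A \<le> \<phi> B"
  shows "\<exists>m. Poly_Mapping.keys m \<subseteq> C \<and> (\<forall>A\<in>C. cum m A = \<phi> A)"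
  using assms
proof (induction "card C" arbitrary: C)
  case 0
  then show ?case by (intro exI[of _ 0]) auto
next
  case (Suc k)
  then have "C \<noteq> {}" by auto
  then obtain T where T: "T \<in> C" "\<And>B. B \<in> C \<Longrightarrow> B \<le> T"
    using chain_has_greatest[of C] Suc.prems(1) by auto
  define C' where "C' = C - {T}"
  have C: "C = insert T C'" "T \<notin> C'" using T(1) by (auto simp: C'_def)
  have "k = card C'" using Suc.hyps(2) C by simp
  from Suc.hyps(1)[OF this] Suc.prems obtain m
    where m: "Poly_Mapping.keys m \<subseteq> C'" "\<And>A. A \<in> C' \<Longrightarrow> cum m A = \<phi> A"
    unfolding C(1) by auto
  \<comment> \<open>This makes the natural number subtraction \<open>\<phi> T - cum m T\<close>
    below exact.\<close>
  have le: "cum m T \<le> \<phi> T"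
  proof (cases "C' = {}")
    case True
    then have "m = 0" using m(1) by simp
    then show ?thesis by simp
  next
    case False
    then obtain U where U: "U \<in> C'" "\<And>B. B \<in> C' \<Longrightarrow> B \<le> U"
      using chain_has_greatest[of C'] Suc.prems(1) C(1) by auto
    then have "cum m T = cum m U" using m(1) T(2) C(1) by (intro cum_eq_greatest) auto
    then show ?thesis using m(2) U(1) Suc.prems(2)[of U T] T C(1) by auto
  qed
  show ?case
  proof (intro exI conjI ballI)
    show "Poly_Mapping.keys (m + Poly_Mapping.single T (\<phi> T - cum m T)) \<subseteq> C"
      using Poly_Mapping.keys_add[of m "Poly_Mapping.single T (\<phi> T - cum m T)"] m(1) C
      by (auto split: if_splits)
    show "cum (m + Poly_Mapping.single T (\<phi> T - cum m T)) A = \<phi> A" if "A \<in> C" for A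
    proof (cases "A = T")
      case True
      then show ?thesis using le by (simp add: cum_add cum_single)
    next
      case False
      then have "A \<in> C'" "\<not> T \<le> A" using that T(2)[OF that] C by auto
      then show ?thesis using m(2) by (simp add: cum_add cum_single)
    qed
  qed
qed

text \<open>The product of -1 + 1 over U, expanded: alternating terms cancel unless no choice is
  left.\<close>

lemma sum_Pow_alternating:
  assumes "finite U"
  shows "(\<Sum>S\<in>Pow U. (-1) ^ card S) = (if U = {} then 1 else (0::int))"
  using prod_add[OF assms, of "\<lambda>_. -1::int" "\<lambda>_. 1"] assms by (auto simp: power_0_left)

section \<open>Nested exponent vectors\<close>

context matroid_lattice
begin

definition slack :: "('a \<Rightarrow>\<^sub>0 nat) \<Rightarrow> 'a \<Rightarrow> int" where
  "slack m H = int (rk H) - int (cum m H)"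

text \<open>
  If \<open>A < B\<close> are consecutive in the support of \<open>n\<close>, then \<open>slack n B - slack n A\<close> is \<open>rk B - rk A\<close> minus the
  exponent of \<open>B\<close>, so the bounds on the exponents say that the slack increases along the chain.
\<close>

definition nested :: "('a \<Rightarrow>\<^sub>0 nat) set" where
  "nested = {n. (\<forall>A\<in>Poly_Mapping.keys n. \<forall>B\<in>Poly_Mapping.keys n. A \<le> B \<or> B \<le> A) \<and>
    (\<forall>A\<in>Poly_Mapping.keys n. 0 \<le> slack n A) \<and>
    (\<forall>A\<in>Poly_Mapping.keys n. \<forall>B\<in>Poly_Mapping.keys n. A < B \<longrightarrow> slack n A < slack n B)}"

text \<open>\<open>slack m\<close> need not be monotone, since large exponents can accumulate above
  K. Minimising over the flats above K restores monotonicity and bounds the increments by those of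
  \<open>rk\<close> (\<open>res_sup_le\<close>).\<close>

definition res :: "('a \<Rightarrow>\<^sub>0 nat) \<Rightarrow> 'a \<Rightarrow> int" where
  "res m K = Min (slack m ` {K..})"

lemma nested_chain: "n \<in> nested \<Longrightarrow> A \<in> Poly_Mapping.keys n \<Longrightarrow> B \<in> Poly_Mapping.keys n \<Longrightarrow> A \<le> B \<or> B \<le> A"
  and nested_nonneg: "n \<in> nested \<Longrightarrow> A \<in> Poly_Mapping.keys n \<Longrightarrow> 0 \<le> slack n A"
  and nested_less: "n \<in> nested \<Longrightarrow> A \<in> Poly_Mapping.keys n \<Longrightarrow> B \<in> Poly_Mapping.keys n \<Longrightarrow> A < B \<Longrightarrow> slack n A < slack n B"
  by (auto simp: nested_def)

lemma nested_cum_cases: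
  assumes "n \<in> nested"
  obtains "cum n H = 0" "\<And>B. B \<in> Poly_Mapping.keys n \<Longrightarrow> \<not> B \<le> H"
  | A where "A \<in> Poly_Mapping.keys n" "A \<le> H" "cum n H = cum n A"
      "\<And>B. B \<in> Poly_Mapping.keys n \<Longrightarrow> B \<le> H \<Longrightarrow> B \<le> A"
proof (cases "{A \<in> Poly_Mapping.keys n. A \<le> H} = {}")
  case True
  with that(1) show ?thesis by (auto simp: cum_eq_0_iff)
next
  case False
  then obtain A where "A \<in> {A \<in> Poly_Mapping.keys n. A \<le> H}" "\<And>B. B \<in> {A \<in> Poly_Mapping.keys n. A \<le> H} \<Longrightarrow> B \<le> A"
    using chain_has_greatest[of "{A \<in> Poly_Mapping.keys n. A \<le> H}"] nested_chain[OF assms] by auto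
  with that(2) cum_eq_greatest[of n "Poly_Mapping.keys n" A H] show ?thesis by auto
qed

lemma slack_bot_le: "slack m bot \<le> 0"
  by (simp add: slack_def)

text \<open>The definition of \<open>nested\<close> bounds the slack on the support only. At any
  other H, \<open>cum n H\<close> is zero or attained at the greatest support flat below H, and the
  rank has only grown.\<close>

lemma nested_slack_nonneg:
  assumes "n \<in> nested"
  shows "0 \<le> slack n H"
  by (rule nested_cum_cases[OF assms, of H])
    (use nested_nonneg[OF assms] rk_mono[of _ H] in \<open>force simp: slack_def\<close>)+

text \<open>\<open>nested\<close> does not exclude \<open>bot\<close> by name; a positive exponent
  there would exceed \<open>rk bot = 0\<close>.\<close>

lemma nested_bot_notin:
  assumes "n \<in> nested"
  shows "bot \<notin> Poly_Mapping.keys n"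
  using nested_slack_nonneg[OF assms, of bot] lookup_le_cum[of n bot]
  by (auto simp: slack_def in_keys_iff)

lemma res_le: "K \<le> H \<Longrightarrow> res m K \<le> slack m H"
  unfolding res_def by (rule Min_le) auto

lemma res_attained:
  obtains H where "K \<le> H" "res m K = slack m H"
proof -
  have "res m K \<in> slack m ` {K..}" unfolding res_def by (rule Min_in) auto
  with that show ?thesis by auto
qed

lemma res_mono: "K \<le> L \<Longrightarrow> res m K \<le> res m L"
  by (rule res_attained[of L m]) (metis order_trans res_le)

text \<open>For a minimiser H of \<open>res m K\<close>, submodularity shows that joining L raises
  the rank of H at most as much as that of K, while \<open>cum\<close> can only grow; so the join of
  H and L bounds the left side.\<close>

lemma res_sup_le: "res m (sup K L) \<le> res m K + int (rk (sup K L)) - int (rk K)"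
proof (rule res_attained[of K m])
  fix H assume H: "K \<le> H" "res m K = slack m H"
  have "sup H (sup K L) = sup H L" using H(1) by (simp add: sup.absorb1 flip: sup.assoc)
  moreover have "rk K \<le> rk (inf H (sup K L))" using H(1) by (intro rk_mono) simp
  ultimately have "rk (sup H L) + rk K \<le> rk H + rk (sup K L)"
    using submodular[of H "sup K L"] by simp
  moreover have "cum m H \<le> cum m (sup H L)" by (rule cum_mono) simp
  moreover have "res m (sup K L) \<le> slack m (sup H L)"
    using H(1) by (intro res_le sup_mono) auto
  ultimately show ?thesis unfolding H(2) slack_def by linarith
qed

text \<open>A minimiser above A can be pushed down to the greatest support flat below it, and along
  the support the slack increases from A on.\<close>

lemma res_eq_slack:
  assumes "n \<in> nested" "A \<in> Poly_Mapping.keys n"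
  shows "res n A = slack n A"
proof (rule antisym[OF res_le[OF order_refl]], rule res_attained[of A n])
  fix H assume H: "A \<le> H" "res n A = slack n H"
  show "slack n A \<le> res n A"
  proof (rule nested_cum_cases[OF assms(1), of H])
    assume "\<And>B. B \<in> Poly_Mapping.keys n \<Longrightarrow> \<not> B \<le> H"
    with assms(2) H(1) show ?thesis by blast
  next
    fix B assume B: "B \<in> Poly_Mapping.keys n" "B \<le> H" "cum n H = cum n B"
      "\<And>B'. B' \<in> Poly_Mapping.keys n \<Longrightarrow> B' \<le> H \<Longrightarrow> B' \<le> B"
    have "A \<le> B" using B(4) assms(2) H(1) by blast
    then have "slack n A \<le> slack n B"
      using nested_less[OF assms(1,2) B(1)] by (cases "A = B") (auto simp: less_le)
    also have "slack n B \<le> slack n H" using rk_mono[OF B(2)] B(3) by (simp add: slack_def)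
    finally show ?thesis using H(2) by simp
  qed
qed

text \<open>A minimiser H matters only through the greatest support flat A below it; replacing H by
  the join of K and A can only lower the rank. \<open>bot\<close> stands for the case that no
  support flat lies below H.\<close>

lemma res_ge_key:
  assumes "n \<in> nested"
  obtains A where "A \<in> insert bot (Poly_Mapping.keys n)"
    "slack n A + int (rk (sup K A)) - int (rk A) \<le> res n K"
proof (rule res_attained[of K n])
  fix H assume H: "K \<le> H" "res n K = slack n H"
  show ?thesis
  proof (rule nested_cum_cases[OF assms, of H])
    assume "cum n H = 0"
    then have "slack n bot + int (rk (sup K bot)) - int (rk bot) \<le> res n K"
      using H rk_mono[OF H(1)] slack_bot_le[of n] by (simp add: slack_def)
    then show ?thesis using that by blast
  next
    fix A assume A: "A \<in> Poly_Mapping.keys n" "A \<le> H" "cum n H = cum n A"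
    have "rk (sup K A) \<le> rk H" using A(2) H(1) by (intro rk_mono) simp
    then have "slack n A + int (rk (sup K A)) - int (rk A) \<le> res n K"
      unfolding H(2) using A(3) by (simp add: slack_def)
    then show ?thesis using that A(1) by blast
  qed
qed

text \<open>Bounds on the support of f propagate to all flats: \<open>res_ge_key\<close> bounds
  \<open>res f K\<close> from below by a slack at a support flat plus a rank increment, and by
  \<open>res_sup_le\<close> the function \<open>res n\<close> grows by no more than that
  increment.\<close>

lemma res_pointwise_le:
  assumes "f \<in> nested" and le: "\<And>A. A \<in> Poly_Mapping.keys f \<Longrightarrow> res n A \<le> slack f A"
  shows "res n K \<le> res f K"
proof (rule res_ge_key[OF assms(1), of K])
  fix A assume A: "A \<in> insert bot (Poly_Mapping.keys f)"
    "slack f A + int (rk (sup K A)) - int (rk A) \<le> res f K"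
  \<comment> \<open>\<open>bot\<close> is not a support flat, but its bound holds for free:
    \<open>slack f bot\<close> is 0 and \<open>res n bot\<close> is at most 0.\<close>
  have "res n bot \<le> slack f bot"
    using order_trans[OF res_le[of bot bot n] slack_bot_le] nested_slack_nonneg[OF assms(1), of bot]
    by simp
  then have "res n A \<le> slack f A" using A(1) le by blast
  moreover have "res n K \<le> res n (sup A K)" by (rule res_mono) simp
  ultimately show ?thesis
    using res_sup_le[of n A K] A(2) by (simp add: sup.commute)
qed

text \<open>
  The two lemmas below treat a flat \<open>A\<close> of smallest residual rank at which \<open>f\<close> and \<open>n\<close> could differ.
\<close>

lemma nested_determined_step:
  assumes f: "f \<in> nested" and n: "n \<in> nested" and eq: "res f = res n"
    and A: "A \<in> Poly_Mapping.keys f"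
    and least: "\<And>B. res f B < res f A \<Longrightarrow> Poly_Mapping.lookup f B = Poly_Mapping.lookup n B"
  shows "\<exists>B\<in>Poly_Mapping.keys n. A \<le> B \<and> res f B = res f A"
proof (rule res_ge_key[OF n, of A])
  fix B assume B: "B \<in> insert bot (Poly_Mapping.keys n)"
    "slack n B + int (rk (sup A B)) - int (rk B) \<le> res n A"
  have fA: "Poly_Mapping.lookup f A > 0" using A by (simp add: in_keys_iff)
  \<comment> \<open>With B = \<open>bot\<close> the bound would give A its full rank as slack,
    leaving no room for its positive exponent.\<close>
  have "B \<noteq> bot"
  proof
    assume "B = bot"
    then have "int (rk A) \<le> slack f A"
      using B(2) nested_slack_nonneg[OF n, of bot] res_eq_slack[OF f A] eq by simp
    with fA lookup_le_cum[of f A] show False by (simp add: slack_def)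
  qed
  with B(1) have Bn: "B \<in> Poly_Mapping.keys n" by simp
  have le: "res f B + int (rk (sup A B)) - int (rk B) \<le> res f A"
    using B(2) res_eq_slack[OF n Bn] eq by simp
  have mono: "rk B \<le> rk (sup A B)" by (rule rk_mono) simp
  show ?thesis
  proof (cases "res f B = res f A")
    case True
    then have "rk (sup A B) = rk B" using le mono by simp
    then have "B = sup A B"
      using rk_strict_mono[of B "sup A B"] by (metis less_irrefl less_le sup_ge2)
    then have "A \<le> B" by (metis sup_ge1)
    with True Bn show ?thesis by blast
  next
    case False
    then have less: "res f B < res f A" using le mono by simp
    \<comment> \<open>By minimality of A, a strictly smaller residual rank puts B into the support
      of f, hence below A. But then passing from B to A costs the positive exponent of A, which the
      rank bound forbids.\<close>
    then have Bf: "B \<in> Poly_Mapping.keys f" using least Bn by (simp add: in_keys_iff)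
    have "\<not> A \<le> B" using res_mono[of A B f] less by auto
    then have "B < A" using nested_chain[OF f A Bf] by auto
    then have "int (rk A) - int (rk B) \<le> slack f A - slack f B"
      using le res_eq_slack[OF f A] res_eq_slack[OF f Bf] by (simp add: sup.absorb1)
    moreover have "cum f B + Poly_Mapping.lookup f A \<le> cum f A" by (rule cum_less) fact
    ultimately have False using fA by (simp add: slack_def)
    then show ?thesis ..
  qed
qed

lemma nested_determined_aux:
  assumes f: "f \<in> nested" and n: "n \<in> nested" and eq: "res f = res n"
    and A: "A \<in> Poly_Mapping.keys f"
    and least: "\<And>B. res f B < res f A \<Longrightarrow> Poly_Mapping.lookup f B = Poly_Mapping.lookup n B"
  shows "Poly_Mapping.lookup f A = Poly_Mapping.lookup n A"
proof -
  \<comment> \<open>Going from f to n and back gives A <= B <= Z with equal residual rank. Strict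
    growth of the slack on the support of f forces A = Z, so A lies in both supports.\<close>
  obtain B where B: "B \<in> Poly_Mapping.keys n" "A \<le> B" "res f B = res f A"
    using nested_determined_step[OF assms] by blast
  obtain Z where Z: "Z \<in> Poly_Mapping.keys f" "B \<le> Z" "res f Z = res f A"
    using nested_determined_step[OF n f eq[symmetric] B(1)] least B(3) eq by force
  have "A = Z"
  proof (rule ccontr)
    assume "A \<noteq> Z"
    then have "A < Z" using B(2) Z(2) by auto
    from nested_less[OF f A Z(1) this] show False
      using res_eq_slack[OF f A] res_eq_slack[OF f Z(1)] Z(3) by simp
  qed
  then have "B = A" using B(2) Z(2) by simp
  with B have An: "A \<in> Poly_Mapping.keys n" by simp
  have "slack f A = slack n A"
    using res_eq_slack[OF f A] res_eq_slack[OF n An] eq by simp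
  then have "cum f A = cum n A" by (simp add: slack_def)
  \<comment> \<open>Any support flat of f or n strictly below A has smaller residual rank, so the
    exponents below A agree; with equal \<open>cum\<close> at A, so do the exponents at A.\<close>
  moreover have "(\<Sum>B | B < A. Poly_Mapping.lookup f B) = (\<Sum>B | B < A. Poly_Mapping.lookup n B)"
  proof (rule sum.cong[OF refl])
    fix B assume "B \<in> {B. B < A}"
    then have "B < A" by simp
    show "Poly_Mapping.lookup f B = Poly_Mapping.lookup n B"
    proof (cases "B \<in> Poly_Mapping.keys f \<or> B \<in> Poly_Mapping.keys n")
      case True
      then have "res f B < res f A"
        using nested_less[OF f _ A \<open>B < A\<close>] nested_less[OF n _ An \<open>B < A\<close>]
          res_eq_slack[OF f] res_eq_slack[OF n] A An eq by metis
      then show ?thesis by (rule least)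
    qed (simp add: in_keys_iff)
  qed
  ultimately show ?thesis by (simp add: cum_split)
qed

lemma nested_determined:
  assumes f: "f \<in> nested" and n: "n \<in> nested" and eq: "res f = res n"
  shows "f = n"
proof (rule ccontr)
  assume "f \<noteq> n"
  define \<Delta> where "\<Delta> = {A. Poly_Mapping.lookup f A \<noteq> Poly_Mapping.lookup n A}"
  have "\<Delta> \<noteq> {}" using \<open>f \<noteq> n\<close> by (auto simp: \<Delta>_def intro: poly_mapping_eqI)
  then have "arg_min_on (res f) \<Delta> \<in> \<Delta>" by (intro arg_min_if_finite) auto
  moreover define A where "A = arg_min_on (res f) \<Delta>"
  ultimately have A: "A \<in> \<Delta>" by simp
  have least: "Poly_Mapping.lookup f B = Poly_Mapping.lookup n B" if "res f B < res f A" for B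
    using arg_min_least[of \<Delta> B "res f"] that \<open>\<Delta> \<noteq> {}\<close>
    by (fastforce simp: \<Delta>_def A_def)
  have "A \<in> Poly_Mapping.keys f \<or> A \<in> Poly_Mapping.keys n"
    using A by (auto simp: \<Delta>_def in_keys_iff)
  then show False
  proof
    assume "A \<in> Poly_Mapping.keys f"
    from nested_determined_aux[OF f n eq this least] A show False by (simp add: \<Delta>_def)
  next
    assume "A \<in> Poly_Mapping.keys n"
    from nested_determined_aux[OF n f eq[symmetric] this] least A eq show False
      by (simp add: \<Delta>_def)
  qed
qed

end

section \<open>The degree functional\<close>

lemma lookup_of_int_mult: "Poly_Mapping.lookup (of_int c * p :: 'v int_mpoly) m = c * Poly_Mapping.lookup p m"
  by (induction c rule: int_induct[of _ 0]) (simp_all add: lookup_add lookup_minus algebra_simps)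

context matroid_lattice
begin

definition tops :: "('a \<Rightarrow>\<^sub>0 nat) set" where
  "tops = {m. cum m Orderings.top = rk Orderings.top \<and> (\<forall>H. cum m H \<le> rk H)}"

lemma finite_tops: "finite tops"
proof (rule finite_subset[OF _ finite_bounded_exponents[of "rk Orderings.top"]])
  have "Poly_Mapping.lookup m F \<le> rk Orderings.top" if "m \<in> tops" for m F
    using lookup_le_cum[of m F] cum_mono[OF top_greatest, of m F] that by (simp add: tops_def)
  then show "tops \<subseteq> {m. \<forall>F. Poly_Mapping.lookup m F \<le> rk Orderings.top}" by blast
qed

text \<open>A plain sum of coefficients on all polynomials, so additivity is automatic. Only
  coefficients of degree r enter, and the passage to the ring is left to
  \<open>degf_chowI\<close>.\<close>

definition degf :: "'a int_mpoly \<Rightarrow> int" where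
  "degf p = (\<Sum>m\<in>tops. Poly_Mapping.lookup p m)"

lemma degf_0 [simp]: "degf 0 = 0"
  and degf_add: "degf (p + q) = degf p + degf q"
  and degf_diff: "degf (p - q) = degf p - degf q"
  by (simp_all add: degf_def lookup_add lookup_minus sum.distrib sum_subtractf)

lemma degf_sum: "degf (sum f A) = (\<Sum>i\<in>A. degf (f i))"
  by (induction A rule: infinite_finite_induct) (simp_all add: degf_add)

lemma degf_single: "degf (Poly_Mapping.single m c) = (if m \<in> tops then c else 0)"
  using finite_tops by (simp add: degf_def lookup_single when_def)

lemma degf_of_int_mult: "degf (of_int c * p) = c * degf p"
  by (simp add: degf_def lookup_of_int_mult sum_distrib_left)

lemma degf_mult: "degf (p * q) = (\<Sum>m\<in>Poly_Mapping.keys p. Poly_Mapping.lookup p m * degf (mon m * q))"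
proof -
  have "p * q = (\<Sum>m\<in>Poly_Mapping.keys p. Poly_Mapping.single m (Poly_Mapping.lookup p m)) * q"
    using sum_monomials[of p] by (rule arg_cong)
  also have "\<dots> = (\<Sum>m\<in>Poly_Mapping.keys p. of_int (Poly_Mapping.lookup p m) * (mon m * q))"
    unfolding sum_distrib_right
    by (intro sum.cong refl) (subst single_of_int_mult, rule mult.assoc)
  finally show ?thesis by (simp only: degf_sum degf_of_int_mult)
qed

lemma degf_mult_eq_0:
  assumes "\<And>m. degf (mon m * p) = 0"
  shows "degf (q * p) = 0"
  by (subst degf_mult) (simp add: assms)

lemma degf_atom_square:
  assumes "atom a"
  shows "degf (q * mvar a ^ 2) = 0"
proof (rule degf_mult_eq_0)
  fix m
  have "2 \<le> cum (m + Poly_Mapping.single a 2) a"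
    by (simp add: cum_add cum_single)
  then have "m + Poly_Mapping.single a 2 \<notin> tops"
    using rk_atom[OF assms] by (auto simp: tops_def intro!: exI[of _ a])
  then show "degf (mon m * mvar a ^ 2) = 0"
    by (simp add: mvar_power mult_single degf_single)
qed

text \<open>Replacing F by its join with a changes \<open>cum\<close> only at flats H above F but
  not above a. There the bound follows from the one at the join of H and a, which counts two factors
  and has rank at most one larger.\<close>

lemma degf_atom_sup:
  assumes "atom a"
  shows "degf (q * (mvar a * mvar F - mvar a * mvar (sup F a))) = 0"
proof (rule degf_mult_eq_0)
  fix m
  define u where "u = (\<lambda>G :: 'a. m + (Poly_Mapping.single a 1 + Poly_Mapping.single G (1::nat)))"
  have cum_u: "cum (u G) H = cum m H + (if a \<le> H then 1 else 0) + (if G \<le> H then 1 else 0)" for G H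
    by (simp add: u_def cum_add cum_single)
  have "u F \<in> tops \<longleftrightarrow> u (sup F a) \<in> tops"
  proof
    assume F: "u F \<in> tops"
    then have bnd: "\<And>H. cum (u F) H \<le> rk H" by (simp add: tops_def)
    have "cum (u (sup F a)) H \<le> rk H" for H
      using bnd[of H] by (auto simp: cum_u)
    moreover have "cum (u (sup F a)) Orderings.top = cum (u F) Orderings.top" by (simp add: cum_u)
    ultimately show "u (sup F a) \<in> tops" using F by (simp add: tops_def)
  next
    assume F: "u (sup F a) \<in> tops"
    then have bnd: "\<And>H. cum (u (sup F a)) H \<le> rk H" by (simp add: tops_def)
    have "cum (u F) H \<le> rk H" for H
    proof (cases "F \<le> H \<and> \<not> a \<le> H")
      case True
      have "cum m H \<le> cum m (sup H a)" by (rule cum_mono) simp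
      moreover have "cum m (sup H a) + 2 \<le> rk (sup H a)"
        using bnd[of "sup H a"] True by (simp add: cum_u le_supI1 sup.coboundedI1 split: if_splits)
      ultimately show ?thesis using rk_sup_atom_le[OF assms, of H] True by (simp add: cum_u)
    next
      case False
      then show ?thesis using bnd[of H] by (auto simp: cum_u split: if_splits)
    qed
    moreover have "cum (u (sup F a)) Orderings.top = cum (u F) Orderings.top" by (simp add: cum_u)
    ultimately show "u F \<in> tops" using F by (simp add: tops_def)
  qed
  moreover have mv: "mon m * (mvar a * mvar G) = mon (u G)" for G
    by (simp only: mvar_def u_def mult_single mult_1)
  ultimately show "degf (mon m * (mvar a * mvar F - mvar a * mvar (sup F a))) = 0"
    unfolding right_diff_distrib mv degf_diff degf_single by simp
qed

text \<open>
  If \<open>F\<close> and \<open>G\<close> both violate the bound, submodularity of \<open>rk\<close> and supermodularity of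
  \<open>cum m\<close> force \<open>2 * (F \<squnion> G)\<close> to violate it as well; hence the four terms cancel.
\<close>

lemma degf_pair:
  fixes F G :: 'a
  shows "degf (q * ((mvar F - mvar (sup G F)) * (mvar G - mvar (sup G F)))) = 0"
proof (rule degf_mult_eq_0)
  fix m
  define Z where "Z = sup G F"
  have ZFG: "Z \<le> H \<longleftrightarrow> G \<le> H \<and> F \<le> H" for H by (simp add: Z_def)
  define u where "u = (\<lambda>A B :: 'a. m + (Poly_Mapping.single A 1 + Poly_Mapping.single B (1::nat)))"
  have cum_u: "cum (u A B) H = cum m H + (if A \<le> H then 1 else 0) + (if B \<le> H then 1 else 0)" for A B H
    by (simp add: u_def cum_add cum_single)
  define t where "t = (\<lambda>A B. if u A B \<in> tops then (1::int) else 0)"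
  have "t F G - t F Z - t Z G + t Z Z = 0"
  proof (cases "u Z Z \<in> tops")
    case False
    \<comment> \<open>Z is the largest of the three flats, so \<open>u Z Z\<close> has the smallest
      \<open>cum\<close>: if it violates the bound, all terms do.\<close>
    have "u A B \<notin> tops" if "{A, B} \<subseteq> {F, G, Z}" for A B
    proof
      assume u: "u A B \<in> tops"
      have "cum (u Z Z) H \<le> cum (u A B) H" for H
        using that by (auto simp: cum_u ZFG)
      moreover have "cum (u Z Z) Orderings.top = cum (u A B) Orderings.top" by (simp add: cum_u)
      ultimately have "u Z Z \<in> tops" using u by (auto simp: tops_def intro: order_trans)
      with False show False ..
    qed
    from this[of F G] this[of F Z] this[of Z G] False show ?thesis
      by (simp add: t_def)
  next
    case True
    \<comment> \<open>\<open>bad A\<close>: some flat above A, but not above Z, is already saturated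
      by m, so a factor A in place of Z no longer fits.\<close>
    define bad where "bad = (\<lambda>A. \<exists>H. A \<le> H \<and> \<not> Z \<le> H \<and> cum m H = rk H)"
    have bnd: "cum (u Z Z) H \<le> rk H" for H using True by (simp add: tops_def)
    have bndm: "cum m H \<le> rk H" for H using bnd[of H] by (simp add: cum_u split: if_splits)
    have tot: "cum (u A B) Orderings.top = rk Orderings.top" for A B
      using True by (simp add: tops_def cum_u)
    have le1: "cum m H + 1 \<le> rk H" if "A \<le> H" "\<not> Z \<le> H" "\<not> bad A" for A H
      using that bndm[of H] by (auto simp: bad_def le_less)
    have FZ: "u F Z \<in> tops \<longleftrightarrow> \<not> bad F"
    proof
      assume "u F Z \<in> tops"
      then have b: "cum (u F Z) H \<le> rk H" for H by (simp add: tops_def)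
      have False if "F \<le> H" "\<not> Z \<le> H" "cum m H = rk H" for H
        using that b[of H] by (auto simp: cum_u)
      then show "\<not> bad F" unfolding bad_def by blast
    next
      assume "\<not> bad F"
      then have "cum (u F Z) H \<le> rk H" for H
        using le1[of F H] bnd[of H] bndm[of H] by (auto simp: cum_u ZFG split: if_splits)
      then show "u F Z \<in> tops" using tot by (simp add: tops_def)
    qed
    have ZG: "u Z G \<in> tops \<longleftrightarrow> \<not> bad G"
    proof
      assume "u Z G \<in> tops"
      then have b: "cum (u Z G) H \<le> rk H" for H by (simp add: tops_def)
      have False if "G \<le> H" "\<not> Z \<le> H" "cum m H = rk H" for H
        using that b[of H] by (auto simp: cum_u)
      then show "\<not> bad G" unfolding bad_def by blast
    next
      assume "\<not> bad G"
      then have "cum (u Z G) H \<le> rk H" for H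
        using le1[of G H] bnd[of H] bndm[of H] by (auto simp: cum_u ZFG split: if_splits)
      then show "u Z G \<in> tops" using tot by (simp add: tops_def)
    qed
    \<comment> \<open>A flat above both F and G is above Z, so elsewhere the two new factors never
      count at the same H and the two conditions do not interact.\<close>
    have FG: "u F G \<in> tops \<longleftrightarrow> \<not> bad F \<and> \<not> bad G"
    proof
      assume "u F G \<in> tops"
      then have b: "cum (u F G) H \<le> rk H" for H by (simp add: tops_def)
      have False if "A \<in> {F, G}" "A \<le> H" "\<not> Z \<le> H" "cum m H = rk H" for A H
        using that b[of H] by (auto simp: cum_u ZFG)
      then show "\<not> bad F \<and> \<not> bad G" unfolding bad_def by blast
    next
      assume "\<not> bad F \<and> \<not> bad G"
      then have "cum (u F G) H \<le> rk H" for H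
        using le1[of F H] le1[of G H] bnd[of H] bndm[of H] by (auto simp: cum_u ZFG split: if_splits)
      then show "u F G \<in> tops" using tot by (simp add: tops_def)
    qed
    \<comment> \<open>By inclusion-exclusion the alternating sum is the indicator of
      \<open>bad F \<and> bad G\<close>.\<close>
    have "\<not> (bad F \<and> bad G)"
    proof
      assume "bad F \<and> bad G"
      then obtain A B where A: "F \<le> A" "cum m A = rk A" and B: "G \<le> B" "cum m B = rk B"
        unfolding bad_def by blast
      have "Z \<le> sup A B" using A(1) B(1) by (auto simp: ZFG intro: le_supI1 le_supI2)
      then have "cum m (sup A B) + 2 \<le> rk (sup A B)" using bnd[of "sup A B"] by (simp add: cum_u)
      then show False
        using cum_supermodular[of m A B] submodular[of A B] bndm[of "inf A B"] A(2) B(2) by simp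
    qed
    then show ?thesis using True by (auto simp: t_def FZ ZG FG)
  qed
  moreover have mv: "mon m * (mvar A * mvar B) = mon (u A B)" for A B
    by (simp only: mvar_def u_def mult_single mult_1)
  have expand: "mon m * ((mvar F - mvar Z) * (mvar G - mvar Z)) =
      mon m * (mvar F * mvar G) - mon m * (mvar F * mvar Z) - mon m * (mvar Z * mvar G) + mon m * (mvar Z * mvar Z)"
    by (simp add: algebra_simps)
  ultimately show "degf (mon m * ((mvar F - mvar (sup G F)) * (mvar G - mvar (sup G F)))) = 0"
    unfolding Z_def[symmetric] expand mv degf_add degf_diff degf_single t_def by simp
qed

end

section \<open>Dual elements\<close>

context matroid_lattice
begin

lemma homogeneous_iff: "homogeneous k p \<longleftrightarrow> (\<forall>m\<in>Poly_Mapping.keys p. int (cum m (Orderings.top::'a)) = k)"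
  by (simp add: homogeneous_def cum_top_keys)

text \<open>A linear extension of the pointwise order on \<open>res\<close>: pointwise comparison of
  two different functions gives a strictly smaller sum, so least elements and induction over finite
  sets are available.\<close>

definition potential :: "('a \<Rightarrow>\<^sub>0 nat) \<Rightarrow> int" where
  "potential n = (\<Sum>K\<in>UNIV. res n K)"

text \<open>
  With \<open>F_1 < \<dots> < F_l\<close> the proper flats in the support of \<open>f\<close> and \<open>F_{l+1} = E\<close>, the polynomial \<open>y\<close> is a monomial
  times the product of the \<open>h_{F_{i+1}} - h_{F_i}\<close>. In the expansion, choosing \<open>F_i\<close> rather than \<open>F_{i+1}\<close> for
  \<open>i \<in> S\<close> only raises \<open>cum\<close> by one at the flats above \<open>F_i\<close> and not above \<open>F_{i+1}\<close>. So the terms cancel unless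
  for each \<open>i\<close> one of these flats is already saturated.
\<close>

lemma exists_dual:
  assumes f: "f \<in> nested"
  obtains y where "\<And>m. m \<in> Poly_Mapping.keys y \<Longrightarrow>
      bot \<notin> Poly_Mapping.keys m \<and> int (cum m Orderings.top) = int (rk Orderings.top) - int (cum f Orderings.top)"
    "degf (mon f * y) = 1"
    "\<And>n. n \<in> nested \<Longrightarrow> n \<noteq> f \<Longrightarrow> degf (mon n * y) \<noteq> 0 \<Longrightarrow> potential n < potential f"
proof -
  \<comment> \<open>The top flat is adjoined so that \<open>z S\<close> can reach the complementary
    degree. Removing \<open>bot\<close> only matters in rank 0, where it is the top flat and not a
    variable. C0 holds the flats at which there is a choice.\<close>
  define C where "C = insert Orderings.top (Poly_Mapping.keys f) - {bot}"
  define C0 where "C0 = Poly_Mapping.keys f - {Orderings.top}"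
  have fin: "finite C0" by (simp add: C0_def)
  have botf: "bot \<notin> Poly_Mapping.keys f" by (rule nested_bot_notin[OF f])
  have keysC: "Poly_Mapping.keys f \<subseteq> C" using botf by (auto simp: C_def)
  have C0C: "C0 \<subseteq> C" using keysC by (auto simp: C0_def)
  have chainC: "A \<le> B \<or> B \<le> A" if "A \<in> C" "B \<in> C" for A B
    using that nested_chain[OF f] by (auto simp: C_def)
  \<comment> \<open>Strict growth persists up to the top flat even if it is outside the support: no
    exponent is added there while the rank increases.\<close>
  have slack_less: "slack f A < slack f B" if "A \<in> C" "B \<in> C" "A < B" for A B
  proof (cases "B \<in> Poly_Mapping.keys f")
    case True
    have "A \<in> Poly_Mapping.keys f" using that by (auto simp: C_def)
    then show ?thesis using nested_less[OF f _ True \<open>A < B\<close>] by simp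
  next
    case False
    then have B: "B = Orderings.top" using that(2) by (auto simp: C_def)
    have Af: "A \<in> Poly_Mapping.keys f" using that B by (auto simp: C_def)
    show ?thesis
    proof (rule nested_cum_cases[OF f, of B])
      assume "\<And>B'. B' \<in> Poly_Mapping.keys f \<Longrightarrow> \<not> B' \<le> B"
      with Af B show ?thesis by auto
    next
      fix Y assume Y: "Y \<in> Poly_Mapping.keys f" "Y \<le> B" "cum f B = cum f Y"
        "\<And>B'. B' \<in> Poly_Mapping.keys f \<Longrightarrow> B' \<le> B \<Longrightarrow> B' \<le> Y"
      have "A \<le> Y" using Y(4) Af B by simp
      then have "slack f A \<le> slack f Y"
        using nested_less[OF f Af Y(1)] by (cases "A = Y") (auto simp: less_le)
      moreover have "Y < B" using Y(1,2) False by (auto simp: less_le)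
      then have "slack f Y < slack f B" using rk_strict_mono[of Y B] Y(3) by (simp add: slack_def)
      ultimately show ?thesis by simp
    qed
  qed
  have slack_nonneg: "0 \<le> slack f A" for A by (rule nested_slack_nonneg[OF f])
  \<comment> \<open>\<open>z S\<close> is specified by its cumulative sums. For empty S they use up
    exactly the slack of f on C; strict growth of that slack leaves room for one more unit at the
    flats of S without losing monotonicity.\<close>
  define \<phi> where "\<phi> = (\<lambda>S A. nat (slack f A) + (if A \<in> S then 1 else 0))"
  have "\<exists>z. Poly_Mapping.keys z \<subseteq> C \<and> (\<forall>A\<in>C. cum z A = \<phi> S A)" for S
  proof (rule exists_exponent_of_cum)
    show "\<phi> S A \<le> \<phi> S B" if "A \<in> C" "B \<in> C" "A \<le> B" for A B
    proof (cases "A = B")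
      case False
      with slack_less[OF that(1,2)] that(3) have "slack f A < slack f B" by simp
      then show ?thesis using slack_nonneg[of A] by (auto simp: \<phi>_def)
    qed simp
  qed (rule chainC)
  then obtain z where keysz: "\<And>S. Poly_Mapping.keys (z S) \<subseteq> C"
    and cumz: "\<And>S A. A \<in> C \<Longrightarrow> cum (z S) A = \<phi> S A" by metis
  define y where "y = (\<Sum>S\<in>Pow C0. Poly_Mapping.single (z S) ((-1::int) ^ card S))"
  \<comment> \<open>A represents H: these H form the range above A and not above the next flat of
    the chain, on which \<open>cum (z S)\<close> is constant.\<close>
  define below where "below = (\<lambda>A H. A \<in> C \<and> A \<le> H \<and> (\<forall>B\<in>C. B \<le> H \<longrightarrow> B \<le> A))"
  have cumz_below: "int (cum (z S) H) = slack f A + (if A \<in> S then 1 else 0)" if "below A H" for S A H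
  proof -
    have "cum (z S) H = cum (z S) A"
      using that keysz by (intro cum_eq_greatest[of _ C]) (auto simp: below_def)
    then show ?thesis using that cumz slack_nonneg[of A] by (auto simp: below_def \<phi>_def)
  qed
  have cumf_below: "cum f H = cum f A" if "below A H" for A H
    using that keysC by (intro cum_eq_greatest[of _ C]) (auto simp: below_def)
  have below_cases: "(\<exists>A. below A H) \<or> (\<forall>B\<in>C. \<not> B \<le> H)" for H
  proof (cases "{A \<in> C. A \<le> H} = {}")
    case False
    then obtain A where "A \<in> {A \<in> C. A \<le> H}" "\<And>B. B \<in> {A \<in> C. A \<le> H} \<Longrightarrow> B \<le> A"
      using chain_has_greatest[of "{A \<in> C. A \<le> H}"] chainC by auto
    then show ?thesis by (auto simp: below_def)
  qed auto
  have cum_none: "cum m H = 0" if "Poly_Mapping.keys m \<subseteq> C" "\<forall>B\<in>C. \<not> B \<le> H" for m H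
    using that by (auto simp: cum_eq_0_iff)
  have cumz_top: "int (cum (z S) Orderings.top) = int (rk Orderings.top) - int (cum f Orderings.top)"
    if "S \<subseteq> C0" for S
  proof (cases "Orderings.top \<in> C")
    case True
    then have "below Orderings.top Orderings.top" by (auto simp: below_def)
    from cumz_below[OF this, of S] that show ?thesis by (auto simp: C0_def slack_def)
  next
    case False
    then have "(Orderings.top :: 'a) = bot" by (auto simp: C_def)
    then have "C = {}" by (auto simp: C_def) (metis bot.extremum_uniqueI top_greatest)
    then have "z S = 0" "f = 0" using keysz[of S] keysC by auto
    then show ?thesis using \<open>Orderings.top = bot\<close> by simp
  qed
  \<comment> \<open>\<open>A \<in> tight n\<close> says that in the range of A some H leaves n
    exactly the slack that \<open>z {}\<close> uses up, so choosing A would overflow.\<close>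
  define tight where "tight = (\<lambda>n. {A \<in> C0. \<exists>H. below A H \<and> slack n H = slack f A})"
  have mem_tops: "n + z S \<in> tops \<longleftrightarrow> n + z {} \<in> tops \<and> S \<inter> tight n = {}" if S: "S \<subseteq> C0" for n S
  proof (intro iffI conjI)
    assume T: "n + z S \<in> tops"
    then have bnd: "cum n H + cum (z S) H \<le> rk H" for H by (simp add: tops_def cum_add)
    have "cum n H + cum (z {}) H \<le> rk H" for H
    proof (rule disjE[OF below_cases[of H]])
      assume "\<exists>A. below A H"
      then obtain A where "below A H" ..
      from cumz_below[OF this, of S] cumz_below[OF this, of "{}"] bnd[of H] show ?thesis
        by (auto split: if_splits)
    qed (use bnd[of H] cum_none[OF keysz] in simp)
    moreover have "cum (z {}) Orderings.top = cum (z S) Orderings.top"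
      using cumz_top[OF S] cumz_top[of "{}"] by simp
    ultimately show "n + z {} \<in> tops" using T by (simp add: tops_def cum_add)
    show "S \<inter> tight n = {}"
    proof (rule equals0I)
      fix A assume "A \<in> S \<inter> tight n"
      then obtain H where "A \<in> S" "below A H" "slack n H = slack f A" by (auto simp: tight_def)
      with cumz_below[of A H S] bnd[of H] show False by (simp add: slack_def)
    qed
  next
    assume T: "n + z {} \<in> tops \<and> S \<inter> tight n = {}"
    then have bnd: "cum n H + cum (z {}) H \<le> rk H" for H by (simp add: tops_def cum_add)
    have "cum n H + cum (z S) H \<le> rk H" for H
    proof (rule disjE[OF below_cases[of H]])
      assume "\<exists>A. below A H"
      then obtain A where A: "below A H" ..
      have "slack f A < slack n H" if "A \<in> S"
      proof -
        have notin: "A \<notin> tight n" using that T by blast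
        have "slack f A \<noteq> slack n H" using notin A S that by (auto simp: tight_def)
        moreover have "slack f A \<le> slack n H"
          using cumz_below[OF A, of "{}"] bnd[of H] by (simp add: slack_def)
        ultimately show ?thesis by simp
      qed
      with cumz_below[OF A, of S] cumz_below[OF A, of "{}"] bnd[of H] show ?thesis
        by (auto simp: slack_def split: if_splits)
    qed (use bnd[of H] cum_none[OF keysz] in simp)
    moreover have "cum (z {}) Orderings.top = cum (z S) Orderings.top"
      using cumz_top[OF S] cumz_top[of "{}"] by simp
    ultimately show "n + z S \<in> tops" using T by (simp add: tops_def cum_add)
  qed
  have degf_y: "degf (mon n * y) = (if n + z {} \<in> tops \<and> C0 \<subseteq> tight n then 1 else 0)" for n
  proof -
    have "degf (mon n * y) = (\<Sum>S\<in>Pow C0. if n + z S \<in> tops then (-1) ^ card S else 0)"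
      unfolding y_def sum_distrib_left degf_sum mult_single degf_single by (simp only: mult_1)
    also have "\<dots> = (\<Sum>S\<in>Pow C0. if n + z {} \<in> tops \<and> S \<inter> tight n = {} then (-1) ^ card S else 0)"
    proof (rule sum.cong[OF refl])
      fix S assume "S \<in> Pow C0"
      then have e: "n + z S \<in> tops \<longleftrightarrow> n + z {} \<in> tops \<and> S \<inter> tight n = {}"
        by (intro mem_tops) simp
      show "(if n + z S \<in> tops then (-1::int) ^ card S else 0) =
          (if n + z {} \<in> tops \<and> S \<inter> tight n = {} then (-1) ^ card S else 0)"
        by (simp only: e)
    qed
    \<comment> \<open>Only subsets avoiding \<open>tight n\<close> survive, all under the same
      condition on \<open>z {}\<close>; their signs cancel unless the empty set is the only
      one.\<close>
    also have "\<dots> = (\<Sum>S\<in>Pow (C0 - tight n). if n + z {} \<in> tops then (-1) ^ card S else 0)"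
      using fin by (intro sum.mono_neutral_cong_right) auto
    also have "\<dots> = (if n + z {} \<in> tops \<and> C0 \<subseteq> tight n then 1 else 0)"
      using sum_Pow_alternating[of "C0 - tight n"] fin by (cases "n + z {} \<in> tops") auto
    finally show ?thesis .
  qed
  show ?thesis
  proof (rule that[of y])
    fix m assume "m \<in> Poly_Mapping.keys y"
    then obtain S where "S \<subseteq> C0" "m = z S"
      using keys_sum[of "\<lambda>S. Poly_Mapping.single (z S) ((-1::int) ^ card S)" "Pow C0"]
      by (auto simp: y_def split: if_splits)
    then show "bot \<notin> Poly_Mapping.keys m \<and> int (cum m Orderings.top) = int (rk Orderings.top) - int (cum f Orderings.top)"
      using keysz[of S] cumz_top by (auto simp: C_def)
  next
    have "cum f H + cum (z {}) H \<le> rk H" for H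
    proof (rule disjE[OF below_cases[of H]])
      assume "\<exists>A. below A H"
      then obtain A where A: "below A H" ..
      then have "rk A \<le> rk H" by (intro rk_mono) (simp add: below_def)
      then show ?thesis using cumz_below[OF A, of "{}"] cumf_below[OF A] by (simp add: slack_def)
    qed (simp add: cum_none[OF keysz] cum_none[OF keysC])
    moreover have "cum f Orderings.top + cum (z {}) Orderings.top = rk Orderings.top"
      using cumz_top[of "{}"] by simp
    ultimately have "f + z {} \<in> tops" by (simp add: tops_def cum_add)
    \<comment> \<open>For n = f each flat A of C0 is its own witness, with H = A.\<close>
    moreover have "C0 \<subseteq> tight f" using C0C by (auto simp: tight_def below_def)
    ultimately show "degf (mon f * y) = 1" by (simp add: degf_y)
  next
    fix n assume n: "n \<in> nested" "n \<noteq> f" "degf (mon n * y) \<noteq> 0"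
    then have T: "n + z {} \<in> tops" and sub: "C0 \<subseteq> tight n" by (auto simp: degf_y split: if_splits)
    \<comment> \<open>At proper support flats tightness provides a witness above A; at the top flat
      the equality of degrees does.\<close>
    have "res n A \<le> slack f A" if "A \<in> Poly_Mapping.keys f" for A
    proof (cases "A = Orderings.top")
      case True
      have "slack n Orderings.top = slack f Orderings.top"
        using T cumz_top[of "{}"] by (simp add: tops_def cum_add slack_def)
      then show ?thesis using res_le[of A A n] True by simp
    next
      case False
      then have "A \<in> tight n" using sub that by (auto simp: C0_def)
      then obtain H where "A \<le> H" "slack n H = slack f A" by (auto simp: tight_def below_def)
      then show ?thesis using res_le[of A H n] by simp
    qed
    then have le: "res n K \<le> res f K" for K by (rule res_pointwise_le[OF f])
    moreover have "res n \<noteq> res f" using nested_determined[OF n(1) f] n(2) by blast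
    then obtain K where "res n K \<noteq> res f K" by blast
    ultimately show "potential n < potential f"
      unfolding potential_def by (intro sum_strict_mono_ex1) (auto simp: less_le)
  qed
qed

end

section \<open>Congruence modulo the Chow ideal\<close>

abbreviation flat_polys :: "'a::{finite,complete_lattice} int_mpoly set" where
  "flat_polys \<equiv> carrier (flat_poly_ring TYPE('a))"

lemma mem_flat_polys: "p \<in> flat_polys \<longleftrightarrow> (\<forall>m\<in>Poly_Mapping.keys p. bot \<notin> Poly_Mapping.keys m)"
  by (auto simp: mpoly_ring_def)

lemma flat_polys_simps [simp]:
  shows flat_polys_0: "0 \<in> flat_polys" and flat_polys_1: "1 \<in> flat_polys"
    and flat_polys_of_int: "of_int c \<in> flat_polys"
    and flat_polys_mvar: "F \<noteq> bot \<Longrightarrow> mvar F \<in> flat_polys"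
    and flat_polys_mon: "bot \<notin> Poly_Mapping.keys m \<Longrightarrow> mon m \<in> flat_polys"
proof -
  show "of_int c \<in> flat_polys" unfolding mem_flat_polys by (subst single_of_int[symmetric]) simp
qed (auto simp: mem_flat_polys mvar_def)

lemma flat_polys_add [simp]: "p \<in> flat_polys \<Longrightarrow> q \<in> flat_polys \<Longrightarrow> p + q \<in> flat_polys"
  using Poly_Mapping.keys_add[of p q] by (fastforce simp: mem_flat_polys)

lemma flat_polys_diff [simp]: "p \<in> flat_polys \<Longrightarrow> q \<in> flat_polys \<Longrightarrow> p - q \<in> flat_polys"
  by (rule minus_in_carrier)

lemma flat_polys_mult [simp]: "p \<in> flat_polys \<Longrightarrow> q \<in> flat_polys \<Longrightarrow> p * q \<in> flat_polys"
  by (rule carrier_mpoly_ring_times)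

lemma flat_polys_power [simp]: "p \<in> flat_polys \<Longrightarrow> p ^ k \<in> flat_polys"
  by (induction k) auto

lemma flat_polys_sum [simp]: "(\<And>i. i \<in> A \<Longrightarrow> f i \<in> flat_polys) \<Longrightarrow> sum f A \<in> flat_polys"
  by (induction A rule: infinite_finite_induct) auto

abbreviation chowI :: "'a::{finite,complete_lattice} int_mpoly set" where
  "chowI \<equiv> chow_ideal TYPE('a)"

lemma chowI_subset: "p \<in> chowI \<Longrightarrow> p \<in> flat_polys"
  using ideal.Icarr[OF ideal_chow_ideal] .

lemma chowI_0: "0 \<in> chowI"
  using additive_subgroup.zero_closed[OF ideal.axioms(1)[OF ideal_chow_ideal]] by (simp add: mpoly_ring_def)

lemma chowI_add: "p \<in> chowI \<Longrightarrow> q \<in> chowI \<Longrightarrow> p + q \<in> chowI"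
  using additive_subgroup.a_closed[OF ideal.axioms(1)[OF ideal_chow_ideal]] by (simp add: mpoly_ring_def)

lemma chowI_mult: "p \<in> chowI \<Longrightarrow> c \<in> flat_polys \<Longrightarrow> c * p \<in> chowI"
  using ideal.I_l_closed[OF ideal_chow_ideal, of p c] by (simp add: mpoly_ring_def)

lemma chowI_uminus: "p \<in> chowI \<Longrightarrow> - p \<in> chowI"
  using chowI_mult[of p "of_int (-1)"] flat_polys_of_int[of "-1"] by simp

lemma chowI_diff: "p \<in> chowI \<Longrightarrow> q \<in> chowI \<Longrightarrow> p - q \<in> chowI"
  using chowI_add[of p "- q"] chowI_uminus[of q] by simp

lemma atom_neq_bot: "atom a \<Longrightarrow> a \<noteq> bot"
  by (auto simp: atom_def)

definition chow_gens1 :: "'a::{finite,complete_lattice} int_mpoly set" where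
  "chow_gens1 = {(mvar F - mvar (sup G F)) * (mvar G - mvar (sup G F)) | F G :: 'a. F \<noteq> bot \<and> G \<noteq> bot}"

definition chow_gens2 :: "'a::{finite,complete_lattice} int_mpoly set" where
  "chow_gens2 = {mvar a ^ 2 | a :: 'a. atom a} \<union>
       {mvar a * mvar F - mvar a * mvar (sup F a) | a F :: 'a. atom a \<and> F \<noteq> bot}"

lemma chow_gens_subset: "chow_gens1 \<subseteq> flat_polys" "chow_gens2 \<subseteq> flat_polys"
  by (auto simp: chow_gens1_def chow_gens2_def atom_neq_bot intro!: flat_polys_mult flat_polys_diff flat_polys_power)

lemma chowI_eq:
  "(chowI :: 'a::{finite,complete_lattice} int_mpoly set) =
    Idl\<^bsub>flat_poly_ring TYPE('a)\<^esub> chow_gens1 <+>\<^bsub>flat_poly_ring TYPE('a)\<^esub> Idl\<^bsub>flat_poly_ring TYPE('a)\<^esub> chow_gens2"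
  by (simp add: chow_ideal_def chow_gens1_def chow_gens2_def)

lemma chow_gens_in_chowI:
  fixes p :: "'a::{finite,complete_lattice} int_mpoly"
  assumes "p \<in> chow_gens1 \<or> p \<in> chow_gens2"
  shows "p \<in> chowI"
proof -
  interpret R: cring "flat_poly_ring TYPE('a)" by (rule cring_mpoly_ring)
  have z: "0 \<in> Idl\<^bsub>flat_poly_ring TYPE('a)\<^esub> S" if "S \<subseteq> flat_polys" for S :: "'a int_mpoly set"
    using additive_subgroup.zero_closed[OF ideal.axioms(1)[OF R.genideal_ideal[OF that]]]
    by (simp add: mpoly_ring_def)
  have add: "x \<oplus>\<^bsub>flat_poly_ring TYPE('a)\<^esub> y = x + y" for x y by (simp add: mpoly_ring_def)
  show ?thesis unfolding chowI_eq set_add_def' add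
    using assms R.genideal_self[OF chow_gens_subset(1)] R.genideal_self[OF chow_gens_subset(2)]
      z[OF chow_gens_subset(1)] z[OF chow_gens_subset(2)] by force
qed

lemma chowI_least:
  fixes J :: "'a::{finite,complete_lattice} int_mpoly set"
  assumes J: "ideal J (flat_poly_ring TYPE('a))" and "chow_gens1 \<subseteq> J" "chow_gens2 \<subseteq> J"
  shows "chowI \<subseteq> J"
proof -
  interpret R: cring "flat_poly_ring TYPE('a)" by (rule cring_mpoly_ring)
  have add: "x + y \<in> J" if "x \<in> J" "y \<in> J" for x y
    using additive_subgroup.a_closed[OF ideal.axioms(1)[OF J] that] by (simp add: mpoly_ring_def)
  have plus: "x \<oplus>\<^bsub>flat_poly_ring TYPE('a)\<^esub> y = x + y" for x y by (simp add: mpoly_ring_def)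
  show ?thesis
    unfolding chowI_eq set_add_def' plus
    using R.genideal_minimal[OF J assms(2)] R.genideal_minimal[OF J assms(3)] by (blast intro: add)
qed

text \<open>Stated for polynomials rather than cosets, so that straightening uses ordinary ring
  algebra; \<open>chow_class_eq_iff\<close> translates back.\<close>

definition chow_cong :: "'a::{finite,complete_lattice} int_mpoly \<Rightarrow> 'a int_mpoly \<Rightarrow> bool" (infix "\<approx>\<^sub>C" 50) where
  "p \<approx>\<^sub>C q \<longleftrightarrow> p - q \<in> chowI"

lemma chow_cong_refl [simp]: "p \<approx>\<^sub>C p"
  by (simp add: chow_cong_def chowI_0)

lemma chow_cong_sym: "p \<approx>\<^sub>C q \<Longrightarrow> q \<approx>\<^sub>C p"
  using chowI_uminus[of "p - q"] by (simp add: chow_cong_def)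

lemma chow_cong_trans [trans]: "p \<approx>\<^sub>C q \<Longrightarrow> q \<approx>\<^sub>C s \<Longrightarrow> p \<approx>\<^sub>C s"
  using chowI_add[of "p - q" "q - s"] by (simp add: chow_cong_def)

lemma chow_cong_add: "p \<approx>\<^sub>C q \<Longrightarrow> p' \<approx>\<^sub>C q' \<Longrightarrow> p + p' \<approx>\<^sub>C q + q'"
  using chowI_add[of "p - q" "p' - q'"] by (simp add: chow_cong_def algebra_simps)

lemma chow_cong_diff: "p \<approx>\<^sub>C q \<Longrightarrow> p' \<approx>\<^sub>C q' \<Longrightarrow> p - p' \<approx>\<^sub>C q - q'"
  using chowI_diff[of "p - q" "p' - q'"] by (simp add: chow_cong_def algebra_simps)

lemma chow_cong_mult: "p \<approx>\<^sub>C q \<Longrightarrow> c \<in> flat_polys \<Longrightarrow> c * p \<approx>\<^sub>C c * q"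
  using chowI_mult[of "p - q" c] by (simp add: chow_cong_def algebra_simps)

lemma chow_cong_sum: "(\<And>i. i \<in> A \<Longrightarrow> f i \<approx>\<^sub>C g i) \<Longrightarrow> sum f A \<approx>\<^sub>C sum g A"
  by (induction A rule: infinite_finite_induct) (auto intro: chow_cong_add)

lemma mvar_pair:
  assumes "F \<noteq> bot" "G \<noteq> bot"
  shows "mvar F * mvar G \<approx>\<^sub>C mvar F * mvar (sup G F) + mvar G * mvar (sup G F) - mvar (sup G F) ^ 2"
proof -
  have "(mvar F - mvar (sup G F)) * (mvar G - mvar (sup G F)) \<in> chow_gens1"
    using assms by (auto simp: chow_gens1_def)
  then have "(mvar F - mvar (sup G F)) * (mvar G - mvar (sup G F)) \<in> chowI"
    using chow_gens_in_chowI by blast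
  then show ?thesis by (simp add: chow_cong_def power2_eq_square algebra_simps)
qed

lemma mvar_atom_square: "atom a \<Longrightarrow> mvar a ^ 2 \<approx>\<^sub>C 0"
  using chow_gens_in_chowI[of "mvar a ^ 2"] by (auto simp: chow_cong_def chow_gens2_def)

lemma mvar_atom_sup: "atom a \<Longrightarrow> F \<noteq> bot \<Longrightarrow> mvar a * mvar F \<approx>\<^sub>C mvar a * mvar (sup F a)"
  using chow_gens_in_chowI[of "mvar a * mvar F - mvar a * mvar (sup F a)"]
  by (auto simp: chow_cong_def chow_gens2_def)

context matroid_lattice
begin

text \<open>Write G as the join of F and an atom a. The relation for the pair F, a rewrites h_F h_a
  as h_F h_G + h_a h_G - h_G^2, the relation for atoms as h_a h_G; the common term cancels.\<close>

lemma mvar_covers: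
  fixes F G :: 'a
  assumes "covers G F" "F \<noteq> bot"
  shows "mvar F * mvar G \<approx>\<^sub>C mvar G ^ 2"
proof -
  obtain a where a: "atom a" "sup F a = G" using exists_atom_sup[OF assms(1)] .
  have "mvar F * mvar a \<approx>\<^sub>C mvar F * mvar G + mvar a * mvar G - mvar G ^ 2"
    using mvar_pair[OF assms(2) atom_neq_bot[OF a(1)]] a(2) by (simp add: sup.commute)
  moreover have "mvar F * mvar a \<approx>\<^sub>C mvar a * mvar G"
    using mvar_atom_sup[OF a(1) assms(2)] a(2) by (simp add: mult.commute)
  ultimately have "mvar a * mvar G \<approx>\<^sub>C mvar F * mvar G + mvar a * mvar G - mvar G ^ 2"
    using chow_cong_trans chow_cong_sym by blast
  then show ?thesis
    using chowI_uminus by (fastforce simp: chow_cong_def algebra_simps)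
qed

lemma mvar_mult_power_covered:
  fixes G H :: 'a
  assumes "covers G H" "H \<noteq> bot"
  shows "mvar G * mvar H ^ j \<approx>\<^sub>C mvar G ^ Suc j"
proof (induction j)
  case (Suc j)
  have Gb: "G \<noteq> bot" using assms by (auto simp: covers_def)
  have "mvar H * (mvar G * mvar H ^ j) \<approx>\<^sub>C mvar H * mvar G ^ Suc j"
    by (rule chow_cong_mult[OF Suc flat_polys_mvar[OF assms(2)]])
  also have "mvar H * mvar G ^ Suc j = mvar G ^ j * (mvar H * mvar G)" by (simp add: algebra_simps)
  also have "\<dots> \<approx>\<^sub>C mvar G ^ j * mvar G ^ 2"
    by (rule chow_cong_mult[OF mvar_covers[OF assms] flat_polys_power[OF flat_polys_mvar[OF Gb]]])
  finally show ?case by (simp add: algebra_simps power2_eq_square)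
qed simp

text \<open>In the induction step, for H covered by G and strictly above F, the product h_F h_G
  h_H^d is evaluated twice: induction turns h_F h_H^d into h_H^(d+1), and
  \<open>mvar_mult_power_covered\<close> turns powers of h_H next to h_G into powers of h_G.\<close>

lemma mvar_less_power:
  assumes "F < G" "F \<noteq> bot" "rk G = rk F + d"
  shows "mvar F * mvar G ^ d \<approx>\<^sub>C mvar G ^ Suc d"
  using assms
proof (induction d arbitrary: G)
  case 0
  then show ?case using rk_strict_mono[of F G] by simp
next
  case (Suc d)
  obtain H where H: "F \<le> H" "covers G H" using exists_covered[OF Suc.prems(1)] .
  have Hb: "H \<noteq> bot" using H(1) Suc.prems(2) by (auto simp: bot_unique)
  have Gb: "G \<noteq> bot" using Suc.prems(1) by auto
  have HG: "mvar H * mvar G \<approx>\<^sub>C mvar G ^ 2" by (rule mvar_covers[OF H(2) Hb])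
  note pow = mvar_mult_power_covered[OF H(2) Hb]
  show ?case
  proof (cases "F = H")
    case True
    then have "d = 0" using rk_covers[OF H(2)] Suc.prems(3) by simp
    then show ?thesis using HG True by (simp add: power2_eq_square)
  next
    case False
    then have "mvar F * mvar H ^ d \<approx>\<^sub>C mvar H ^ Suc d"
      using Suc.IH[of H] H(1) Suc.prems rk_covers[OF H(2)] by simp
    then have "mvar G * (mvar F * mvar H ^ d) \<approx>\<^sub>C mvar G * mvar H ^ Suc d"
      by (rule chow_cong_mult[OF _ flat_polys_mvar[OF Gb]])
    also have "\<dots> \<approx>\<^sub>C mvar G ^ Suc (Suc d)" by (rule pow)
    finally have 1: "mvar G * (mvar F * mvar H ^ d) \<approx>\<^sub>C mvar G ^ Suc (Suc d)" .
    have "mvar F * (mvar G * mvar H ^ d) \<approx>\<^sub>C mvar F * mvar G ^ Suc d"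
      by (rule chow_cong_mult[OF pow flat_polys_mvar[OF Suc.prems(2)]])
    from chow_cong_trans[OF chow_cong_sym[OF this]] 1 show ?thesis by (simp add: mult_ac)
  qed
qed

text \<open>For an atom this is a defining relation. Otherwise, for H covered by G, h_G h_H^(rk G)
  equals h_G^(rk G + 1), and h_H^(rk H + 1) vanishes already.\<close>

lemma mvar_power_rk:
  assumes "rk G = Suc d"
  shows "mvar G ^ Suc (Suc d) \<approx>\<^sub>C 0"
  using assms
proof (induction d arbitrary: G)
  case 0
  then have "atom G" by (intro rk_eq_1_atom) simp
  from mvar_atom_square[OF this] show ?case by (simp add: power2_eq_square)
next
  case (Suc d)
  have "bot < G" using Suc.prems eq_bot_iff_rk[of G] bot.not_eq_extremum[of G] by auto
  then obtain H where H: "covers G H" using exists_covered by metis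
  have rkH: "rk H = Suc d" using rk_covers[OF H] Suc.prems by simp
  then have Hb: "H \<noteq> bot" using eq_bot_iff_rk[of H] by simp
  have Gb: "G \<noteq> bot" using \<open>bot < G\<close> by auto
  note pow = mvar_mult_power_covered[OF H Hb]
  have "mvar G * mvar H ^ Suc (Suc d) \<approx>\<^sub>C mvar G * 0"
    by (rule chow_cong_mult[OF Suc.IH[OF rkH] flat_polys_mvar[OF Gb]])
  from chow_cong_trans[OF chow_cong_sym[OF pow] this] show ?case by simp
qed

lemma degf_chowI:
  assumes "p \<in> chowI"
  shows "degf p = 0"
proof -
  interpret R: cring "flat_poly_ring TYPE('a)" by (rule cring_mpoly_ring)
  \<comment> \<open>The kernel of \<open>degf\<close> need not be an ideal; quantifying over all
    multiples gives one inside it, and then only generators have to be tested.\<close>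
  define J where "J = {p :: 'a int_mpoly. p \<in> flat_polys \<and> (\<forall>q. degf (q * p) = 0)}"
  have "ideal J (flat_poly_ring TYPE('a))"
  proof (rule idealI[OF R.ring_axioms])
    show "subgroup J (add_monoid (flat_poly_ring TYPE('a)))"
    proof (rule R.add.subgroupI)
      show "J \<subseteq> flat_polys" "J \<noteq> {}"
        unfolding J_def by (auto intro!: exI[of _ 0])
      show "\<ominus>\<^bsub>flat_poly_ring TYPE('a)\<^esub> x \<in> J" if "x \<in> J" for x
      proof -
        have x: "x \<in> flat_polys" using that by (simp add: J_def)
        have "\<ominus>\<^bsub>flat_poly_ring TYPE('a)\<^esub> x = 0 - x"
          using x flat_polys_diff[OF flat_polys_0 x] by (intro R.minus_equality) (auto simp: mpoly_ring_def)
        then show ?thesis using that by (simp add: J_def degf_diff right_diff_distrib del: diff_0)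
      qed
      show "x \<oplus>\<^bsub>flat_poly_ring TYPE('a)\<^esub> y \<in> J" if "x \<in> J" "y \<in> J" for x y
        using that flat_polys_add[of x y] by (simp add: J_def mpoly_ring_def degf_add distrib_left)
    qed
    have l: "c * x \<in> J" if "x \<in> J" "c \<in> flat_polys" for x c
      using that by (auto simp: J_def simp flip: mult.assoc)
    show "c \<otimes>\<^bsub>flat_poly_ring TYPE('a)\<^esub> x \<in> J" "x \<otimes>\<^bsub>flat_poly_ring TYPE('a)\<^esub> c \<in> J"
      if "x \<in> J" "c \<in> flat_polys" for x c
      using l[OF that] by (simp_all add: mpoly_ring_def mult.commute)
  qed
  moreover have "chow_gens1 \<subseteq> J" "chow_gens2 \<subseteq> J"
  proof -
    have "degf (q * p) = 0" if "p \<in> chow_gens1 \<or> p \<in> chow_gens2" for p q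
      using that degf_pair degf_atom_square degf_atom_sup
      by (auto simp: chow_gens1_def chow_gens2_def)
    then show "chow_gens1 \<subseteq> J" "chow_gens2 \<subseteq> J"
      using chow_gens_subset unfolding J_def by blast+
  qed
  ultimately have "p \<in> J" using chowI_least assms by blast
  then have "degf (1 * p) = 0" unfolding J_def by blast
  then show ?thesis by simp
qed

lemma degf_cong: "p \<approx>\<^sub>C q \<Longrightarrow> degf p = degf q"
  using degf_chowI[of "p - q"] by (simp add: chow_cong_def degf_diff)

end

section \<open>Straightening\<close>

lemma exponent_diff_add:
  fixes m :: "'a \<Rightarrow>\<^sub>0 nat"
  assumes "\<And>F. Poly_Mapping.lookup u F \<le> Poly_Mapping.lookup m F"
  shows "m = u + (m - u)"
  by (rule poly_mapping_eqI) (simp add: lookup_add lookup_minus assms)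

lemma keys_exponent_diff: "Poly_Mapping.keys (m - u) \<subseteq> Poly_Mapping.keys m"
  for m :: "'a \<Rightarrow>\<^sub>0 nat"
  by (auto simp: in_keys_iff lookup_minus)

lemma keys_exponent_add: "Poly_Mapping.keys (m + u) = Poly_Mapping.keys m \<union> Poly_Mapping.keys u"
  for m u :: "'a \<Rightarrow>\<^sub>0 nat"
  by (auto simp: in_keys_iff lookup_add)

context matroid_lattice
begin

text \<open>The measure for termination: straightening keeps the degree and moves factors to larger
  flats, which raises the weight, while \<open>weight_le\<close> bounds it for fixed degree.\<close>

definition weight :: "('a \<Rightarrow>\<^sub>0 nat) \<Rightarrow> nat" where
  "weight m = (\<Sum>F\<in>UNIV. Poly_Mapping.lookup m F * rk F)"

lemma weight_add: "weight (m + n) = weight m + weight n"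
  by (simp add: weight_def lookup_add algebra_simps sum.distrib)

lemma weight_single: "weight (Poly_Mapping.single F a) = a * rk F"
proof -
  have "weight (Poly_Mapping.single F a) = (\<Sum>G\<in>UNIV. if G = F then a * rk F else 0)"
    unfolding weight_def by (intro sum.cong) (auto simp: lookup_single when_def)
  then show ?thesis by simp
qed

lemma weight_le: "weight m \<le> rk Orderings.top * cum m Orderings.top"
proof -
  have "weight m \<le> (\<Sum>F\<in>UNIV. Poly_Mapping.lookup m F * rk Orderings.top)"
    unfolding weight_def by (intro sum_mono mult_le_mono2 rk_mono top_greatest)
  then show ?thesis by (simp add: cum_top sum_distrib_left mult.commute)
qed

lemma mon_step:
  assumes "\<not> (\<forall>A\<in>Poly_Mapping.keys m. \<forall>B\<in>Poly_Mapping.keys m. A \<le> B \<or> B \<le> A)"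
    and bot: "bot \<notin> Poly_Mapping.keys m"
  obtains m1 m2 m3 where "mon m \<approx>\<^sub>C mon m1 + mon m2 - mon m3"
    "\<And>m'. m' \<in> {m1, m2, m3} \<Longrightarrow>
      bot \<notin> Poly_Mapping.keys m' \<and> cum m' Orderings.top = cum m Orderings.top \<and> weight m < weight m'"
proof -
  obtain A B where AB: "A \<in> Poly_Mapping.keys m" "B \<in> Poly_Mapping.keys m" "\<not> A \<le> B" "\<not> B \<le> A"
    using assms(1) by blast
  define Z where "Z = sup B A"
  have lt: "A < Z" "B < Z" using AB(3,4) by (auto simp: Z_def less_le_not_le)
  have nb: "A \<noteq> bot" "B \<noteq> bot" "Z \<noteq> bot" using AB lt by auto
  define u where "u = m - (Poly_Mapping.single A 1 + Poly_Mapping.single B 1)"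
  have m: "m = Poly_Mapping.single A 1 + Poly_Mapping.single B 1 + u"
    unfolding u_def using AB
    by (intro exponent_diff_add) (auto simp: lookup_add lookup_single when_def in_keys_iff Suc_le_eq)
  have bu: "bot \<notin> Poly_Mapping.keys u" unfolding u_def by (rule contra_subsetD[OF keys_exponent_diff bot])
  define v where "v = (\<lambda>F G :: 'a. Poly_Mapping.single F (1::nat) + Poly_Mapping.single G 1 + u)"
  have v: "mon (v F G) = mon u * (mvar F * mvar G)" for F G
    by (simp add: v_def mvar_def mult_single add_ac)
  have "mon m = mon u * (mvar A * mvar B)" using v[of A B] m by (simp add: v_def)
  also have "\<dots> \<approx>\<^sub>C mon u * (mvar A * mvar Z + mvar B * mvar Z - mvar Z ^ 2)"
    using mvar_pair[OF nb(1,2)] bu unfolding Z_def by (intro chow_cong_mult) auto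
  also have "\<dots> = mon (v A Z) + mon (v B Z) - mon (v Z Z)"
    by (simp add: v algebra_simps power2_eq_square)
  finally have 1: "mon m \<approx>\<^sub>C mon (v A Z) + mon (v B Z) - mon (v Z Z)" .
  have "bot \<notin> Poly_Mapping.keys m' \<and> cum m' Orderings.top = cum m Orderings.top \<and> weight m < weight m'"
    if "m' \<in> {v A Z, v B Z, v Z Z}" for m'
    using that bu nb rk_strict_mono[OF lt(1)] rk_strict_mono[OF lt(2)] unfolding m v_def
    by (auto simp: keys_exponent_add cum_add cum_single weight_add weight_single)
  with 1 show ?thesis by (rule that)
qed

text \<open>Consider the lowest flat B where nestedness fails. If B is the least support flat, its
  exponent exceeds \<open>rk B\<close> and the monomial vanishes. Otherwise, with A its predecessor
  in the support, its exponent is at least \<open>rk B - rk A\<close>, and a factor h_A is exchanged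
  for h_B.\<close>

lemma chain_step:
  assumes chain: "\<forall>A\<in>Poly_Mapping.keys m. \<forall>B\<in>Poly_Mapping.keys m. A \<le> B \<or> B \<le> A"
    and bot: "bot \<notin> Poly_Mapping.keys m" and "m \<notin> nested"
  obtains "mon m \<approx>\<^sub>C 0"
  | m' where "mon m \<approx>\<^sub>C mon m'" "bot \<notin> Poly_Mapping.keys m'"
      "cum m' Orderings.top = cum m Orderings.top" "weight m < weight m'"
proof -
  define bad where "bad = (\<lambda>B. slack m B < 0 \<or> (\<exists>A\<in>Poly_Mapping.keys m. A < B \<and> slack m B \<le> slack m A))"
  have "\<exists>B\<in>Poly_Mapping.keys m. bad B"
    using assms(3) chain unfolding nested_def bad_def by (auto simp: not_le not_less)
  then have "{B \<in> Poly_Mapping.keys m. bad B} \<noteq> {}" by blast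
  then obtain B where B: "B \<in> Poly_Mapping.keys m" "bad B"
    and least: "\<And>A. A \<in> Poly_Mapping.keys m \<Longrightarrow> A < B \<Longrightarrow> \<not> bad A"
    using finite_has_minimal[of "{B \<in> Poly_Mapping.keys m. bad B}"] by (fastforce simp: less_le)
  have Bb: "B \<noteq> bot" using B(1) bot by auto
  have split: "m = Poly_Mapping.single B k + (m - Poly_Mapping.single B k)" if "k \<le> Poly_Mapping.lookup m B" for k
    using that by (intro exponent_diff_add) (auto simp: lookup_single when_def)
  show ?thesis
  proof (cases "{A \<in> Poly_Mapping.keys m. A < B} = {}")
    case True
    have "(\<Sum>F | F < B. Poly_Mapping.lookup m F) = 0"
      using True by (intro sum.neutral) (auto simp: in_keys_iff)
    then have "cum m B = Poly_Mapping.lookup m B" by (simp add: cum_split)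
    moreover have "slack m B < 0" using B(2) True by (auto simp: bad_def)
    ultimately have k: "Suc (rk B) \<le> Poly_Mapping.lookup m B" by (simp add: slack_def)
    define u where "u = m - Poly_Mapping.single B (Suc (rk B))"
    have m: "m = Poly_Mapping.single B (Suc (rk B)) + u" using split[OF k] by (simp add: u_def)
    have bu: "bot \<notin> Poly_Mapping.keys u" unfolding u_def by (rule contra_subsetD[OF keys_exponent_diff bot])
    obtain d where d: "rk B = Suc d" using Bb eq_bot_iff_rk[of B] by (cases "rk B") auto
    have "mon m = mon u * mvar B ^ Suc (rk B)"
      unfolding mvar_power mult_single by (subst m) (simp add: add.commute)
    also have "\<dots> \<approx>\<^sub>C mon u * 0"
      using mvar_power_rk[OF d] bu unfolding d by (intro chow_cong_mult) auto
    finally show ?thesis using that(1) by simp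
  next
    case False
    obtain A where "A \<in> {A \<in> Poly_Mapping.keys m. A < B}"
      "\<And>A'. A' \<in> {A \<in> Poly_Mapping.keys m. A < B} \<Longrightarrow> A' \<le> A"
      by (rule chain_has_greatest[OF _ False]) (use chain in auto)
    then have A: "A \<in> Poly_Mapping.keys m" "A < B"
      "\<And>A'. A' \<in> Poly_Mapping.keys m \<Longrightarrow> A' < B \<Longrightarrow> A' \<le> A"
      by auto
    have "\<not> bad A" using least A by blast
    \<comment> \<open>The failure at B may be negativity or a comparison with an earlier flat; since
      A itself is not bad, it transfers to the predecessor A.\<close>
    have "slack m B \<le> slack m A"
    proof (cases "slack m B < 0")
      case True
      then show ?thesis using \<open>\<not> bad A\<close> by (auto simp: bad_def)
    next
      case False
      then obtain A' where A': "A' \<in> Poly_Mapping.keys m" "A' < B" "slack m B \<le> slack m A'"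
        using B(2) by (auto simp: bad_def)
      have "A' \<le> A" by (rule A(3)[OF A'(1,2)])
      then have "slack m A' \<le> slack m A"
        using \<open>\<not> bad A\<close> A'(1) unfolding bad_def by (cases "A' = A") (auto simp: less_le)
      then show ?thesis using A'(3) by simp
    qed
    moreover have "cum m B = Poly_Mapping.lookup m B + cum m A"
    proof -
      have "(\<Sum>F | F < B. Poly_Mapping.lookup m F) = cum m A"
        unfolding cum_def using A by (intro sum.mono_neutral_right) (auto simp: in_keys_iff)
      then show ?thesis by (simp add: cum_split)
    qed
    ultimately have k: "rk B - rk A \<le> Poly_Mapping.lookup m B" by (simp add: slack_def)
    define d where "d = rk B - rk A"
    have d: "rk B = rk A + d" using rk_strict_mono[OF A(2)] by (simp add: d_def)
    have Ab: "A \<noteq> bot" using A(1) bot by auto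
    define u where "u = m - (Poly_Mapping.single A 1 + Poly_Mapping.single B d)"
    have m: "m = Poly_Mapping.single A 1 + Poly_Mapping.single B d + u"
      unfolding u_def using A(1,2) k
      by (intro exponent_diff_add) (auto simp: lookup_add lookup_single when_def d_def in_keys_iff Suc_le_eq)
    have bu: "bot \<notin> Poly_Mapping.keys u" unfolding u_def by (rule contra_subsetD[OF keys_exponent_diff bot])
    have "mon m = mon u * (mvar A * mvar B ^ d)"
      unfolding mvar_power by (subst m) (simp add: mvar_def mult_single add_ac)
    also have "\<dots> \<approx>\<^sub>C mon u * mvar B ^ Suc d"
      using mvar_less_power[OF A(2) Ab d] bu by (intro chow_cong_mult) auto
    also have "mon u * mvar B ^ Suc d = mon (u + Poly_Mapping.single B (Suc d))"
      unfolding mvar_power mult_single by simp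
    finally have 1: "mon m \<approx>\<^sub>C mon (u + Poly_Mapping.single B (Suc d))" .
    have cw: "cum m Orderings.top = Suc d + cum u Orderings.top" "weight m = rk A + d * rk B + weight u"
      by (subst m, simp add: cum_add cum_single weight_add weight_single)+
    show ?thesis
      using rk_strict_mono[OF A(2)] bu Bb
      by (intro that(2)[OF 1]) (auto simp: cw keys_exponent_add cum_add cum_single weight_add weight_single)
  qed
qed

definition nested_supported :: "nat \<Rightarrow> 'a int_mpoly set" where
  "nested_supported k = {q. \<forall>n\<in>Poly_Mapping.keys q. n \<in> nested \<and> cum n Orderings.top = k}"

lemma nested_supported_add: "p \<in> nested_supported k \<Longrightarrow> q \<in> nested_supported k \<Longrightarrow> p + q \<in> nested_supported k"
  and nested_supported_diff: "p \<in> nested_supported k \<Longrightarrow> q \<in> nested_supported k \<Longrightarrow> p - q \<in> nested_supported k"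
  using Poly_Mapping.keys_add[of p q] Poly_Mapping.keys_diff[of p q]
  by (auto simp: nested_supported_def)

lemma mon_straighten:
  assumes "bot \<notin> Poly_Mapping.keys m"
  shows "\<exists>q\<in>nested_supported (cum m Orderings.top). mon m \<approx>\<^sub>C q"
  using assms
proof (induction "rk Orderings.top * cum m Orderings.top - weight m" arbitrary: m rule: less_induct)
  case less
  have IH: "\<exists>q\<in>nested_supported (cum m Orderings.top). mon m' \<approx>\<^sub>C q"
    if "bot \<notin> Poly_Mapping.keys m' \<and> cum m' Orderings.top = cum m Orderings.top \<and> weight m < weight m'" for m'
  proof -
    have "rk Orderings.top * cum m' Orderings.top - weight m' < rk Orderings.top * cum m Orderings.top - weight m"
      using that weight_le[of m'] by (simp add: diff_less_mono2)
    from less.hyps[OF this] that show ?thesis by simp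
  qed
  show ?case
  proof (cases "m \<in> nested")
    case True
    then show ?thesis by (intro bexI[of _ "mon m"]) (auto simp: nested_supported_def)
  next
    case nn: False
    show ?thesis
    proof (cases "\<forall>A\<in>Poly_Mapping.keys m. \<forall>B\<in>Poly_Mapping.keys m. A \<le> B \<or> B \<le> A")
      case True
      from True less.prems nn show ?thesis
      proof (cases rule: chain_step)
        case 1
        then show ?thesis by (intro bexI[of _ 0]) (auto simp: nested_supported_def)
      next
        case (2 m')
        then show ?thesis using IH[of m'] chow_cong_trans by blast
      qed
    next
      case False
      obtain m1 m2 m3 where s: "mon m \<approx>\<^sub>C mon m1 + mon m2 - mon m3"
        and ms: "\<And>m'. m' \<in> {m1, m2, m3} \<Longrightarrow>
          bot \<notin> Poly_Mapping.keys m' \<and> cum m' Orderings.top = cum m Orderings.top \<and> weight m < weight m'"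
        using mon_step[OF False less.prems] by blast
      obtain q1 where q1: "q1 \<in> nested_supported (cum m Orderings.top)" "mon m1 \<approx>\<^sub>C q1" using IH[OF ms, of m1] by auto
      obtain q2 where q2: "q2 \<in> nested_supported (cum m Orderings.top)" "mon m2 \<approx>\<^sub>C q2" using IH[OF ms, of m2] by auto
      obtain q3 where q3: "q3 \<in> nested_supported (cum m Orderings.top)" "mon m3 \<approx>\<^sub>C q3" using IH[OF ms, of m3] by auto
      have "mon m \<approx>\<^sub>C q1 + q2 - q3"
        using chow_cong_trans[OF s chow_cong_diff[OF chow_cong_add[OF q1(2) q2(2)] q3(2)]] .
      then show ?thesis
        using nested_supported_diff[OF nested_supported_add[OF q1(1) q2(1)] q3(1)] by blast
    qed
  qed
qed

lemma straighten:
  fixes p :: "'a int_mpoly"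
  assumes "p \<in> flat_polys"
  obtains q where "p \<approx>\<^sub>C q" "Poly_Mapping.keys q \<subseteq> nested"
    "\<And>n. n \<in> Poly_Mapping.keys q \<Longrightarrow> \<exists>m\<in>Poly_Mapping.keys p. cum n Orderings.top = cum m Orderings.top"
proof -
  have "\<forall>m\<in>Poly_Mapping.keys p. \<exists>q\<in>nested_supported (cum m Orderings.top). mon m \<approx>\<^sub>C q"
    using assms mon_straighten by (auto simp: mem_flat_polys)
  then obtain Q where Q: "\<And>m. m \<in> Poly_Mapping.keys p \<Longrightarrow> Q m \<in> nested_supported (cum m Orderings.top)"
    "\<And>m. m \<in> Poly_Mapping.keys p \<Longrightarrow> mon m \<approx>\<^sub>C Q m" by metis
  define q where "q = (\<Sum>m\<in>Poly_Mapping.keys p. of_int (Poly_Mapping.lookup p m) * Q m)"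
  have "p = (\<Sum>m\<in>Poly_Mapping.keys p. of_int (Poly_Mapping.lookup p m) * mon m)"
    unfolding single_of_int_mult[symmetric] by (rule sum_monomials)
  also have "\<dots> \<approx>\<^sub>C q"
    unfolding q_def using Q(2) by (intro chow_cong_sum chow_cong_mult) auto
  finally have "p \<approx>\<^sub>C q" .
  moreover have "\<exists>m\<in>Poly_Mapping.keys p. n \<in> Poly_Mapping.keys (Q m)" if "n \<in> Poly_Mapping.keys q" for n
  proof (rule ccontr)
    assume "\<not> ?thesis"
    then have "Poly_Mapping.lookup q n = 0"
      by (simp add: q_def lookup_sum lookup_of_int_mult in_keys_iff)
    with that show False by (simp add: in_keys_iff)
  qed
  ultimately show ?thesis
    using Q(1) by (intro that[of q]) (auto simp: nested_supported_def, blast+)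
qed

end

section \<open>Residue classes\<close>

definition chow_class :: "'a::{finite,complete_lattice} int_mpoly \<Rightarrow> 'a int_mpoly set" where
  "chow_class p = chowI +>\<^bsub>flat_poly_ring TYPE('a)\<^esub> p"

lemma hcls_eq: "hcls F = chow_class (mvar F)"
  by (simp add: hcls_def chow_class_def)

lemma carrier_aug_chow_ring: "carrier (aug_chow_ring TYPE('a::{finite,complete_lattice})) = chow_class ` (flat_polys :: 'a int_mpoly set)"
  by (auto simp: aug_chow_ring_def FactRing_def A_RCOSETS_def' chow_class_def)

lemma chow_class_carrier: "p \<in> flat_polys \<Longrightarrow> chow_class (p :: 'a int_mpoly) \<in> carrier (aug_chow_ring TYPE('a::{finite,complete_lattice}))"
  by (simp add: carrier_aug_chow_ring)

lemma chow_class_hom: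
  "(chow_class :: 'a int_mpoly \<Rightarrow> _) \<in> ring_hom (flat_poly_ring TYPE('a)) (aug_chow_ring TYPE('a::{finite,complete_lattice}))"
  using ideal.rcos_ring_hom[OF ideal_chow_ideal] by (simp add: chow_class_def[abs_def] aug_chow_ring_def)

lemma
  fixes p q :: "'a::{finite,complete_lattice} int_mpoly"
  assumes "p \<in> flat_polys" "q \<in> flat_polys"
  shows chow_class_add: "chow_class p \<oplus>\<^bsub>aug_chow_ring TYPE('a)\<^esub> chow_class q = chow_class (p + q)"
    and chow_class_mult: "chow_class p \<otimes>\<^bsub>aug_chow_ring TYPE('a)\<^esub> chow_class q = chow_class (p * q)"
  using ring_hom_add[OF chow_class_hom assms] ring_hom_mult[OF chow_class_hom assms]
  by (simp_all add: mpoly_ring_def)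

lemma chow_class_1: "chow_class (1 :: 'a int_mpoly) = \<one>\<^bsub>aug_chow_ring TYPE('a::{finite,complete_lattice})\<^esub>"
  using ring_hom_one[OF chow_class_hom] by (simp add: mpoly_ring_def)

lemma chow_class_0: "chow_class (0 :: 'a int_mpoly) = \<zero>\<^bsub>aug_chow_ring TYPE('a::{finite,complete_lattice})\<^esub>"
  using ring_hom_zero[OF chow_class_hom cring.axioms(1)[OF cring_mpoly_ring] cring.axioms(1)[OF cring_aug_chow_ring]]
  by (simp add: mpoly_ring_def)

lemma chow_class_eq_iff:
  fixes p q :: "'a::{finite,complete_lattice} int_mpoly"
  assumes "p \<in> flat_polys" "q \<in> flat_polys"
  shows "chow_class p = chow_class q \<longleftrightarrow> p \<approx>\<^sub>C q"
proof -
  interpret R: cring "flat_poly_ring TYPE('a)" by (rule cring_mpoly_ring)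
  have "\<ominus>\<^bsub>flat_poly_ring TYPE('a)\<^esub> q = 0 - q"
    using assms(2) flat_polys_diff[OF flat_polys_0 assms(2)] by (intro R.minus_equality) (auto simp: mpoly_ring_def)
  then have "p \<ominus>\<^bsub>flat_poly_ring TYPE('a)\<^esub> q = p - q"
    by (simp add: a_minus_def mpoly_ring_def)
  then show ?thesis
    using R.quotient_eq_iff_same_a_r_cos[OF ideal_chow_ideal assms] by (simp add: chow_class_def chow_cong_def)
qed

lemma chow_class_power:
  fixes p :: "'a::{finite,complete_lattice} int_mpoly"
  assumes "p \<in> flat_polys"
  shows "chow_class p [^]\<^bsub>aug_chow_ring TYPE('a)\<^esub> (k::nat) = chow_class (p ^ k)"
  using assms by (induction k) (simp_all add: chow_class_1 chow_class_mult mult.commute)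

lemma chow_class_prod:
  fixes p :: "'i \<Rightarrow> 'a::{finite,complete_lattice} int_mpoly"
  assumes "finite S" "\<And>i. i \<in> S \<Longrightarrow> p i \<in> flat_polys"
  shows "(\<Otimes>\<^bsub>aug_chow_ring TYPE('a)\<^esub>i\<in>S. chow_class (p i)) = chow_class (\<Prod>i\<in>S. p i)
    \<and> (\<Prod>i\<in>S. p i) \<in> flat_polys"
proof -
  interpret A: cring "aug_chow_ring TYPE('a)" by (rule cring_aug_chow_ring)
  show ?thesis
    using assms
  proof (induction S)
    case (insert i S)
    then show ?case
      by (subst A.finprod_insert) (auto simp: chow_class_carrier chow_class_mult)
  qed (simp add: chow_class_1)
qed

lemma chow_class_sum:
  fixes p :: "'i \<Rightarrow> 'a::{finite,complete_lattice} int_mpoly"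
  assumes "finite S" "\<And>i. i \<in> S \<Longrightarrow> p i \<in> flat_polys"
  shows "(\<Oplus>\<^bsub>aug_chow_ring TYPE('a)\<^esub>i\<in>S. chow_class (p i)) = chow_class (\<Sum>i\<in>S. p i)"
proof -
  interpret A: cring "aug_chow_ring TYPE('a)" by (rule cring_aug_chow_ring)
  show ?thesis
    using assms
  proof (induction S)
    case (insert i S)
    then show ?case
      by (subst A.finsum_insert) (auto simp: chow_class_carrier chow_class_add)
  qed (simp add: chow_class_0)
qed

lemma chow_class_add_pow:
  fixes p :: "'a::{finite,complete_lattice} int_mpoly"
  assumes p: "p \<in> flat_polys"
  shows "add_pow (aug_chow_ring TYPE('a)) (c::int) (chow_class p) = chow_class (of_int c * p)"
proof -
  interpret A: cring "aug_chow_ring TYPE('a)" by (rule cring_aug_chow_ring)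
  have nat: "add_pow (aug_chow_ring TYPE('a)) (k::nat) (chow_class p) = chow_class (of_nat k * p)
      \<and> of_nat k * p \<in> flat_polys" for k
  proof (induction k)
    case (Suc k)
    then show ?case
      using p by (simp add: A.nat_pow_Suc add_pow_def A.add.nat_pow_Suc chow_class_add distrib_right add.commute)
  qed (simp add: add_pow_def chow_class_0)
  show ?thesis
  proof (cases "c \<ge> 0")
    case True
    then show ?thesis using nat[of "nat c"] by (simp add: add_pow_int_ge)
  next
    case False
    define k where "k = nat (- c)"
    have c: "c = - int k" using False by (simp add: k_def)
    have mem: "of_int c * p \<in> flat_polys" using p by simp
    have "chow_class (of_int c * p) \<oplus>\<^bsub>aug_chow_ring TYPE('a)\<^esub> chow_class (of_nat k * p) = \<zero>\<^bsub>aug_chow_ring TYPE('a)\<^esub>"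
      using nat[of k] mem by (simp add: chow_class_add c chow_class_0 flip: distrib_right)
    then have "\<ominus>\<^bsub>aug_chow_ring TYPE('a)\<^esub> chow_class (of_nat k * p) = chow_class (of_int c * p)"
      using nat[of k] mem by (intro A.minus_equality) (auto simp: chow_class_carrier)
    then show ?thesis using False nat[of k] by (simp add: add_pow_int_lt k_def)
  qed
qed

section \<open>Lists and nested exponent vectors\<close>

definition list_exponent :: "('a \<times> nat) list \<Rightarrow> 'a \<Rightarrow>\<^sub>0 nat" where
  "list_exponent xs = sum_list (map (\<lambda>(F, a). Poly_Mapping.single F a) xs)"

lemma list_exponent_Nil [simp]: "list_exponent [] = 0"
  and list_exponent_snoc: "list_exponent (xs @ [(F, a)]) = list_exponent xs + Poly_Mapping.single F a"
  by (simp_all add: list_exponent_def)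

lemma sorted_wrt_less_snoc:
  fixes B F :: "'a::order"
  shows "sorted_wrt (<) (B # Fs @ [F]) \<longleftrightarrow> sorted_wrt (<) (B # Fs) \<and> last (B # Fs) < F"
proof -
  have "(\<forall>G\<in>set (B # Fs). G < F) \<longleftrightarrow> last (B # Fs) < F" if s: "sorted_wrt (<) (B # Fs)"
  proof
    assume l: "last (B # Fs) < F"
    have "G \<le> last (B # Fs)" if "G \<in> set (B # Fs)" for G
      using s that by (cases Fs rule: rev_cases) (auto simp: sorted_wrt_append less_imp_le)
    with l show "\<forall>G\<in>set (B # Fs). G < F" by (meson le_less_trans)
  qed (use last_in_set[of "B # Fs"] in simp)
  then show ?thesis
    using sorted_wrt_append[of "(<)" "B # Fs" "[F]"] by auto
qed

text \<open>The conditions on the last entry involve only its predecessor, so lists grow at the end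
  exactly as chains grow by a new greatest flat. All comparisons with exponent vectors below use
  this recursion.\<close>

lemma nested_data_snoc:
  "xs @ [(F, a)] \<in> nested_data rk \<longleftrightarrow> xs \<in> nested_data rk \<and> 1 \<le> a \<and>
    (if xs = [] then bot < F \<and> a \<le> rk F else fst (last xs) < F \<and> a < rk F - rk (fst (last xs)))"
proof (cases "xs = []")
  case True
  then show ?thesis by (auto simp: nested_data_def)
next
  case False
  have last: "last xs = xs ! (length xs - 1)" by (rule last_conv_nth[OF False])
  have lastm: "last (map fst xs) = fst (last xs)" by (simp add: last_map False)
  have all: "(\<forall>i<length (xs @ [(F, a)]). P i) \<longleftrightarrow> (\<forall>i<length xs. P i) \<and> P (length xs)" for P
    by (auto simp: less_Suc_eq)
  show ?thesis
    unfolding nested_data_def mem_Collect_eq all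
    using False sorted_wrt_less_snoc[of bot "map fst xs" F]
    by (auto simp: nth_append last lastm Suc_le_eq)
qed

context matroid_lattice
begin

lemma slack_add_single_less: "\<not> F \<le> A \<Longrightarrow> slack (f + Poly_Mapping.single F a) A = slack f A"
  by (simp add: slack_def cum_add cum_single)

text \<open>Appending (F, a) leaves the slack at earlier flats unchanged, and the bound on a says
  exactly that the new slack at F exceeds the slack at the previous flat, or is nonnegative if there
  is none.\<close>

lemma nested_data_exponent:
  assumes "xs \<in> nested_data rk"
  shows "list_exponent xs \<in> nested \<and> Poly_Mapping.keys (list_exponent xs) = set (map fst xs) \<and>
    (xs \<noteq> [] \<longrightarrow> (\<forall>A\<in>set (map fst xs). A \<le> fst (last xs)))"
  using assms
proof (induction xs rule: rev_induct)
  case Nil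
  then show ?case by (simp add: nested_def)
next
  case (snoc x xs)
  obtain F a where x: "x = (F, a)" by (cases x)
  define f where "f = list_exponent xs"
  have xs: "xs \<in> nested_data rk" and a: "1 \<le> a"
    and step: "if xs = [] then bot < F \<and> a \<le> rk F else fst (last xs) < F \<and> a < rk F - rk (fst (last xs))"
    using snoc.prems nested_data_snoc[of xs F a rk] x by auto
  have f: "f \<in> nested" "Poly_Mapping.keys f = set (map fst xs)"
    "xs \<noteq> [] \<Longrightarrow> \<forall>A\<in>set (map fst xs). A \<le> fst (last xs)"
    using snoc.IH[OF xs] by (auto simp: f_def)
  define f' where "f' = f + Poly_Mapping.single F a"
  have lt: "A < F" if "A \<in> Poly_Mapping.keys f" for A
  proof -
    have ne: "xs \<noteq> []" using that f(2) by auto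
    then have "A \<le> fst (last xs)" using f that by auto
    then show ?thesis using step ne by (simp add: le_less_trans)
  qed
  have slackA: "slack f' A = slack f A" if "A \<in> Poly_Mapping.keys f" for A
    unfolding f'_def using lt[OF that] by (intro slack_add_single_less) auto
  have slackF: "0 \<le> slack f' F \<and> (\<forall>A\<in>Poly_Mapping.keys f. slack f A < slack f' F)"
  proof (cases "xs = []")
    case True
    then have "f = 0" by (simp add: f_def)
    then show ?thesis using step True by (simp add: f'_def slack_def cum_single)
  next
    case False
    define L where "L = fst (last xs)"
    have L: "L \<in> Poly_Mapping.keys f" using False f(2) by (auto simp: L_def)
    have great: "A \<le> L" if "A \<in> Poly_Mapping.keys f" for A using f(2,3) False that by (auto simp: L_def)
    have "cum f F = cum f L"
      using lt[OF L] great by (intro cum_eq_greatest[of f "Poly_Mapping.keys f"]) auto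
    moreover have "rk L + a < rk F" using step False by (simp add: L_def less_diff_conv add.commute)
    ultimately have "slack f L < slack f' F" by (simp add: f'_def slack_def cum_add cum_single)
    moreover have "slack f A \<le> slack f L" if "A \<in> Poly_Mapping.keys f" for A
      using nested_less[OF f(1) that L] great[OF that] by (cases "A = L") (auto simp: less_le)
    moreover have "0 \<le> slack f L" by (rule nested_nonneg[OF f(1) L])
    ultimately show ?thesis by force
  qed
  have keys: "Poly_Mapping.keys f' = insert F (Poly_Mapping.keys f)"
    using a by (simp add: f'_def keys_exponent_add)
  have "f' \<in> nested"
    unfolding nested_def mem_Collect_eq keys
  proof (intro conjI ballI impI)
    fix A assume A: "A \<in> insert F (Poly_Mapping.keys f)"
    show "0 \<le> slack f' A" using A slackF slackA[of A] nested_nonneg[OF f(1), of A] by auto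
    fix B assume B: "B \<in> insert F (Poly_Mapping.keys f)"
    show "A \<le> B \<or> B \<le> A" using A B nested_chain[OF f(1), of A B] lt[of A] lt[of B] by auto
    assume AB: "A < B"
    show "slack f' A < slack f' B"
    proof (cases "B = F")
      case True
      then have "A \<in> Poly_Mapping.keys f" using A AB by auto
      then show ?thesis using True slackF slackA by simp
    next
      case False
      then have Bf: "B \<in> Poly_Mapping.keys f" using B by simp
      then have "A \<in> Poly_Mapping.keys f" using A AB lt[OF Bf] by auto
      then show ?thesis using nested_less[OF f(1) _ Bf AB] slackA Bf by simp
    qed
  qed
  moreover have "list_exponent (xs @ [x]) = f'" by (simp add: x list_exponent_snoc f'_def f_def)
  ultimately show ?case using keys f(2) lt by (auto simp: x less_imp_le)
qed

text \<open>Peels off the greatest support flat with its whole exponent; the slack at the other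
  support flats, which lie strictly below, does not change.\<close>

lemma nested_exponent_surj:
  assumes "f \<in> nested"
  shows "\<exists>xs\<in>nested_data rk. list_exponent xs = f"
  using assms
proof (induction "card (Poly_Mapping.keys f)" arbitrary: f)
  case 0
  then have "f = 0" by simp
  then show ?case by (intro bexI[of _ "[]"]) (auto simp: nested_data_def)
next
  case (Suc k)
  then have "Poly_Mapping.keys f \<noteq> {}" by auto
  then obtain F where F: "F \<in> Poly_Mapping.keys f" "\<And>A. A \<in> Poly_Mapping.keys f \<Longrightarrow> A \<le> F"
    using chain_has_greatest[of "Poly_Mapping.keys f"] nested_chain[OF Suc.prems] by auto
  define a where "a = Poly_Mapping.lookup f F"
  define g where "g = f - Poly_Mapping.single F a"
  have f: "f = g + Poly_Mapping.single F a"
    unfolding g_def by (subst add.commute, rule exponent_diff_add) (auto simp: a_def lookup_single when_def)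
  have a: "1 \<le> a" using F(1) by (simp add: a_def in_keys_iff)
  have keys: "Poly_Mapping.keys g = Poly_Mapping.keys f - {F}"
    by (auto simp: g_def a_def in_keys_iff lookup_minus lookup_single when_def split: if_splits)
  have lt: "A < F" if "A \<in> Poly_Mapping.keys g" for A using that F(2) keys by (auto simp: less_le)
  have slackA: "slack f A = slack g A" if "A \<in> Poly_Mapping.keys g" for A
    unfolding f using lt[OF that] by (intro slack_add_single_less) auto
  have sub: "A \<in> Poly_Mapping.keys f" if "A \<in> Poly_Mapping.keys g" for A using that keys by auto
  have g: "g \<in> nested"
    unfolding nested_def mem_Collect_eq
  proof (intro conjI ballI impI)
    fix A assume A: "A \<in> Poly_Mapping.keys g"
    show "0 \<le> slack g A" using nested_nonneg[OF Suc.prems sub[OF A]] slackA[OF A] by simp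
    fix B assume B: "B \<in> Poly_Mapping.keys g"
    show "A \<le> B \<or> B \<le> A" by (rule nested_chain[OF Suc.prems sub[OF A] sub[OF B]])
    assume "A < B"
    from nested_less[OF Suc.prems sub[OF A] sub[OF B] this] show "slack g A < slack g B"
      using slackA[OF A] slackA[OF B] by simp
  qed
  have "k = card (Poly_Mapping.keys g)" using Suc.hyps(2) F(1) by (simp add: keys)
  from Suc.hyps(1)[OF this g] obtain xs where xs: "xs \<in> nested_data rk" "list_exponent xs = g" by blast
  have xs': "Poly_Mapping.keys g = set (map fst xs)" "xs \<noteq> [] \<Longrightarrow> \<forall>A\<in>set (map fst xs). A \<le> fst (last xs)"
    using nested_data_exponent[OF xs(1)] xs(2) by auto
  have "xs @ [(F, a)] \<in> nested_data rk"
    unfolding nested_data_snoc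
  proof (intro conjI xs(1) a)
    show "if xs = [] then bot < F \<and> a \<le> rk F else fst (last xs) < F \<and> a < rk F - rk (fst (last xs))"
    proof (cases "xs = []")
      case True
      then have "g = 0" using xs(2) by simp
      moreover have "F \<noteq> bot" using F(1) nested_bot_notin[OF Suc.prems] by auto
      ultimately show ?thesis
        using True nested_nonneg[OF Suc.prems F(1)] bot.not_eq_extremum[of F] by (simp add: f slack_def cum_single)
    next
      case False
      define L where "L = fst (last xs)"
      have L: "L \<in> Poly_Mapping.keys g" using False xs' by (auto simp: L_def)
      have great: "A \<le> L" if "A \<in> Poly_Mapping.keys g" for A using xs' False that by (auto simp: L_def)
      have "cum g F = cum g L"
        using lt[OF L] great by (intro cum_eq_greatest[of g "Poly_Mapping.keys g"]) auto
      moreover have "slack f L < slack f F"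
        using nested_less[OF Suc.prems _ F(1) lt[OF L]] L keys by auto
      moreover have "cum f L = cum g L" "cum f F = cum g F + a"
        using lt[OF L] by (auto simp: f cum_add cum_single)
      ultimately have "a < rk F - rk L" by (simp add: slack_def)
      then show ?thesis using False lt[OF L] by (simp add: L_def)
    qed
  qed
  moreover have "list_exponent (xs @ [(F, a)]) = f" by (simp add: list_exponent_snoc xs(2) f)
  ultimately show ?case by blast
qed

text \<open>The last entry can be read off the exponent vector: its flat is the greatest of the
  support, and no earlier entry contributes to the exponent there.\<close>

lemma list_exponent_inj: "inj_on list_exponent (nested_data rk)"
proof (rule inj_onI)
  fix xs ys :: "('a \<times> nat) list"
  assume "xs \<in> nested_data rk" "ys \<in> nested_data rk" "list_exponent xs = list_exponent ys"
  then show "xs = ys"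
  proof (induction xs arbitrary: ys rule: rev_induct)
    case Nil
    then show ?case using nested_data_exponent[of ys] by simp
  next
    case (snoc x xs)
    have "ys \<noteq> []" using snoc.prems nested_data_exponent[of "xs @ [x]"] nested_data_exponent[of ys] by auto
    then obtain ys' y where ys: "ys = ys' @ [y]" by (metis append_butlast_last_id)
    obtain F a where x: "x = (F, a)" by (cases x)
    obtain G b where y: "y = (G, b)" by (cases y)
    have keysx: "Poly_Mapping.keys (list_exponent (xs @ [(F, a)])) = insert F (set (map fst xs))"
        "\<forall>A\<in>insert F (set (map fst xs)). A \<le> F" "xs \<in> nested_data rk"
      using nested_data_exponent[of "xs @ [x]"] snoc.prems(1) nested_data_snoc[of xs F a rk] by (auto simp: x)
    have keysy: "Poly_Mapping.keys (list_exponent (ys' @ [(G, b)])) = insert G (set (map fst ys'))"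
        "\<forall>A\<in>insert G (set (map fst ys')). A \<le> G" "ys' \<in> nested_data rk"
      using nested_data_exponent[of "ys' @ [y]"] snoc.prems(2) nested_data_snoc[of ys' G b rk] by (auto simp: y ys)
    have eq: "list_exponent (xs @ [(F, a)]) = list_exponent (ys' @ [(G, b)])"
      using snoc.prems(3) by (simp add: x y ys)
    have FG: "F = G" using keysx(1,2) keysy(1,2) eq by (metis antisym insertI1)
    have notin: "F \<notin> Poly_Mapping.keys (list_exponent zs)" if "zs @ [(F, c)] \<in> nested_data rk" for zs c
    proof -
      have z: "zs \<in> nested_data rk" "zs \<noteq> [] \<Longrightarrow> fst (last zs) < F"
        using that nested_data_snoc[of zs F c rk] by (auto split: if_splits)
      show ?thesis
      proof (cases "zs = []")
        case False
        then show ?thesis using nested_data_exponent[OF z(1)] z(2) by (auto dest: leD)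
      qed simp
    qed
    have "a = b"
      using arg_cong[OF eq, of "\<lambda>m. Poly_Mapping.lookup m F"] notin[of xs a] notin[of ys' b] snoc.prems(1,2)
      by (auto simp: list_exponent_snoc lookup_add FG x y ys in_keys_iff)
    moreover have "xs = ys'"
      using eq FG \<open>a = b\<close> keysx(3) keysy(3) by (intro snoc.IH) (auto simp: list_exponent_snoc)
    ultimately show ?case by (simp add: x y ys FG)
  qed
qed

lemma chow_monomial_eq:
  assumes "xs \<in> nested_data rk"
  shows "chow_monomial xs = chow_class (mon (list_exponent xs))"
proof -
  have "bot \<notin> set (map fst xs)"
    using nested_data_exponent[OF assms] nested_bot_notin by auto
  then have nb: "mvar (fst (xs ! i)) \<in> flat_polys" if "i < length xs" for i
    using that by (intro flat_polys_mvar) (metis length_map nth_map nth_mem)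
  interpret A: cring "aug_chow_ring TYPE('a)" by (rule cring_aug_chow_ring)
  have "chow_monomial xs = (\<Otimes>\<^bsub>aug_chow_ring TYPE('a)\<^esub>i\<in>{..<length xs}. chow_class (mvar (fst (xs ! i)) ^ snd (xs ! i)))"
    unfolding chow_monomial_def hcls_eq
    using nb by (intro A.finprod_cong') (auto simp: chow_class_power chow_class_carrier)
  also have "\<dots> = chow_class (\<Prod>i<length xs. mvar (fst (xs ! i)) ^ snd (xs ! i))"
    using nb by (subst chow_class_prod) auto
  also have "(\<Prod>i<length xs. mvar (fst (xs ! i)) ^ snd (xs ! i)) = mon (list_exponent xs)"
  proof (induction xs rule: rev_induct)
    case (snoc x xs)
    then show ?case by (cases x) (simp add: nth_append list_exponent_snoc mvar_power mult_single)
  qed simp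
  finally show ?thesis .
qed

end

section \<open>Poincare duality\<close>

context matroid_lattice
begin

lemma homogeneous_0: "homogeneous k (0 :: 'a int_mpoly)"
  and homogeneous_add: "homogeneous k p \<Longrightarrow> homogeneous k q \<Longrightarrow> homogeneous k (p + q :: 'a int_mpoly)"
  and homogeneous_diff: "homogeneous k p \<Longrightarrow> homogeneous k q \<Longrightarrow> homogeneous k (p - q :: 'a int_mpoly)"
  and homogeneous_of_int_mult: "homogeneous k p \<Longrightarrow> homogeneous k (of_int c * p :: 'a int_mpoly)"
  using Poly_Mapping.keys_add[of p q] Poly_Mapping.keys_diff[of p q]
  by (auto simp: homogeneous_iff in_keys_iff[of _ "of_int c * p"] lookup_of_int_mult in_keys_iff[of _ p])

lemma finite_nested: "finite nested"
proof (rule finite_subset[OF _ finite_bounded_exponents[of "rk Orderings.top"]])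
  have "Poly_Mapping.lookup m F \<le> rk Orderings.top" if "m \<in> nested" for m F
    using lookup_le_cum[of m F] cum_mono[OF top_greatest, of m F] nested_slack_nonneg[OF that, of Orderings.top]
    by (simp add: slack_def)
  then show "nested \<subseteq> {m. \<forall>F. Poly_Mapping.lookup m F \<le> rk Orderings.top}" by blast
qed

lemma exists_dual_polynomial:
  assumes f: "f \<in> nested"
  obtains y where "y \<in> flat_polys" "homogeneous (int (rk Orderings.top) - int (cum f Orderings.top)) y"
    "degf (mon f * y) = 1"
    "\<And>n. n \<in> nested \<Longrightarrow> n \<noteq> f \<Longrightarrow> degf (mon n * y) \<noteq> 0 \<Longrightarrow> potential n < potential f"
proof -
  obtain y where "\<And>m. m \<in> Poly_Mapping.keys y \<Longrightarrow>
      bot \<notin> Poly_Mapping.keys m \<and> int (cum m Orderings.top) = int (rk Orderings.top) - int (cum f Orderings.top)"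
    "degf (mon f * y) = 1"
    "\<And>n. n \<in> nested \<Longrightarrow> n \<noteq> f \<Longrightarrow> degf (mon n * y) \<noteq> 0 \<Longrightarrow> potential n < potential f"
    using exists_dual[OF f] by blast
  then show ?thesis by (intro that[of y]) (auto simp: mem_flat_polys homogeneous_iff)
qed

text \<open>Take f of least potential in the support of q. By triangularity its dual annihilates
  every other term, so \<open>degf (q * y)\<close> is the coefficient of f. Testing only in degrees
  complementary to the terms of q lets the lemma serve a single graded piece.\<close>

lemma nested_independent:
  assumes keys: "Poly_Mapping.keys q \<subseteq> nested"
    and zero: "\<And>f y. f \<in> Poly_Mapping.keys q \<Longrightarrow> y \<in> flat_polys \<Longrightarrow>
      homogeneous (int (rk Orderings.top) - int (cum f Orderings.top)) y \<Longrightarrow> degf (q * y) = 0"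
  shows "q = 0"
proof (rule ccontr)
  assume "q \<noteq> 0"
  then have ne: "Poly_Mapping.keys q \<noteq> {}" by simp
  define f where "f = arg_min_on potential (Poly_Mapping.keys q)"
  have f: "f \<in> Poly_Mapping.keys q" using arg_min_if_finite(1)[OF _ ne] by (simp add: f_def)
  have least: "potential f \<le> potential n" if "n \<in> Poly_Mapping.keys q" for n
    using arg_min_least[OF _ ne that, of potential] by (simp add: f_def)
  obtain y where y: "y \<in> flat_polys" "homogeneous (int (rk Orderings.top) - int (cum f Orderings.top)) y"
    "degf (mon f * y) = 1"
    "\<And>n. n \<in> nested \<Longrightarrow> n \<noteq> f \<Longrightarrow> degf (mon n * y) \<noteq> 0 \<Longrightarrow> potential n < potential f"
    using exists_dual_polynomial[of f] f keys by blast
  have "degf (q * y) = (\<Sum>n\<in>Poly_Mapping.keys q. if n = f then Poly_Mapping.lookup q f else 0)"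
    unfolding degf_mult[of q y]
  proof (rule sum.cong[OF refl])
    fix n assume n: "n \<in> Poly_Mapping.keys q"
    show "Poly_Mapping.lookup q n * degf (mon n * y) = (if n = f then Poly_Mapping.lookup q f else 0)"
      using y(3) y(4)[of n] least[OF n] keys n by force
  qed
  then have "degf (q * y) = Poly_Mapping.lookup q f" using f by simp
  with zero[OF f y(1,2)] f show False by (simp add: in_keys_iff)
qed

lemma exists_prescribed_degf:
  assumes "finite N" "\<And>n. n \<in> N \<Longrightarrow> n \<in> nested \<and> int (cum n Orderings.top) = j"
  shows "\<exists>x\<in>flat_polys. homogeneous (int (rk Orderings.top) - j) x \<and> (\<forall>n\<in>N. degf (mon n * x) = \<phi> n)"
  using assms
\<comment> \<open>The minus sign inserts exponent vectors in order of decreasing potential, so the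
  dual of the new f vanishes on those treated before, and correcting by a multiple of it changes
  nothing there.\<close>
proof (induction N rule: finite_ranking_induct[where f = "\<lambda>n. - potential n"])
  case empty
  then show ?case by (intro bexI[of _ 0]) (auto simp: homogeneous_0)
next
  case (insert f N)
  obtain x where x: "x \<in> flat_polys" "homogeneous (int (rk Orderings.top) - j) x"
    "\<And>n. n \<in> N \<Longrightarrow> degf (mon n * x) = \<phi> n"
    using insert.IH insert.prems by blast
  have f: "f \<in> nested" "int (cum f Orderings.top) = j" using insert.prems by auto
  obtain y where y: "y \<in> flat_polys" "homogeneous (int (rk Orderings.top) - int (cum f Orderings.top)) y"
    "degf (mon f * y) = 1"
    "\<And>n. n \<in> nested \<Longrightarrow> n \<noteq> f \<Longrightarrow> degf (mon n * y) \<noteq> 0 \<Longrightarrow> potential n < potential f"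
    using exists_dual_polynomial[OF f(1)] by blast
  define c where "c = \<phi> f - degf (mon f * x)"
  define x' where "x' = x + of_int c * y"
  have deg: "degf (mon n * x') = degf (mon n * x) + c * degf (mon n * y)" for n
  proof -
    have "mon n * x' = mon n * x + of_int c * (mon n * y)" by (simp add: x'_def algebra_simps)
    then show ?thesis by (simp only: degf_add degf_of_int_mult)
  qed
  have "degf (mon n * x') = \<phi> n" if "n \<in> insert f N" for n
  proof (cases "n = f")
    case True
    then show ?thesis using y(3) by (simp add: deg c_def)
  next
    case False
    then have n: "n \<in> N" using that by simp
    have "degf (mon n * y) = 0"
      using y(4)[of n] False insert.hyps(2)[OF n] insert.prems n by fastforce
    then show ?thesis using x(3)[OF n] by (simp add: deg)
  qed
  moreover have "x' \<in> flat_polys" using x(1) y(1) by (simp add: x'_def)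
  moreover have "homogeneous (int (rk Orderings.top) - j) x'"
    unfolding x'_def using x(2) y(2) f(2) by (intro homogeneous_add homogeneous_of_int_mult) auto
  ultimately show ?case by blast
qed

section \<open>The basis of nested monomials\<close>

definition list_poly :: "(('a \<times> nat) list \<Rightarrow>\<^sub>0 int) \<Rightarrow> 'a int_mpoly" where
  "list_poly c = (\<Sum>xs\<in>Poly_Mapping.keys c. Poly_Mapping.single (list_exponent xs) (Poly_Mapping.lookup c xs))"

lemma list_poly_add: "list_poly (c + d) = list_poly c + list_poly d"
  unfolding list_poly_def by (rule setsum_keys_plus_distrib) (simp_all add: single_add)

lemma list_poly_0: "list_poly 0 = 0"
  by (simp add: list_poly_def)

lemma list_poly_sum: "list_poly (sum f S) = (\<Sum>i\<in>S. list_poly (f i))"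
  by (induction S rule: infinite_finite_induct) (simp_all add: list_poly_0 list_poly_add)

lemma list_poly_single: "list_poly (Poly_Mapping.single xs a) = Poly_Mapping.single (list_exponent xs) a"
  by (cases "a = 0") (simp_all add: list_poly_def)

lemma lookup_list_poly:
  assumes "Poly_Mapping.keys c \<subseteq> nested_data rk" "xs \<in> nested_data rk"
  shows "Poly_Mapping.lookup (list_poly c) (list_exponent xs) = Poly_Mapping.lookup c xs"
proof -
  have "Poly_Mapping.lookup (list_poly c) (list_exponent xs) =
      (\<Sum>ys\<in>Poly_Mapping.keys c. if ys = xs then Poly_Mapping.lookup c xs else 0)"
    unfolding list_poly_def lookup_sum
  proof (rule sum.cong[OF refl])
    fix ys assume "ys \<in> Poly_Mapping.keys c"
    then have "list_exponent ys = list_exponent xs \<longleftrightarrow> ys = xs"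
      using assms list_exponent_inj by (auto dest: inj_onD)
    then show "Poly_Mapping.lookup (Poly_Mapping.single (list_exponent ys) (Poly_Mapping.lookup c ys)) (list_exponent xs)
        = (if ys = xs then Poly_Mapping.lookup c xs else 0)"
      by (auto simp: lookup_single when_def)
  qed
  then show ?thesis by (auto simp: in_keys_iff)
qed

lemma keys_list_poly:
  assumes "Poly_Mapping.keys c \<subseteq> nested_data rk"
  shows "Poly_Mapping.keys (list_poly c) \<subseteq> nested"
proof
  fix n assume "n \<in> Poly_Mapping.keys (list_poly c)"
  then have "n \<in> (\<Union>xs\<in>Poly_Mapping.keys c. Poly_Mapping.keys (Poly_Mapping.single (list_exponent xs) (Poly_Mapping.lookup c xs)))"
    unfolding list_poly_def by (rule subsetD[OF keys_sum])
  then obtain xs where "xs \<in> Poly_Mapping.keys c" "n = list_exponent xs" by (auto split: if_splits)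
  then show "n \<in> nested" using nested_data_exponent[of xs] assms by auto
qed

lemma nested_supported_flat_polys: "Poly_Mapping.keys q \<subseteq> nested \<Longrightarrow> q \<in> flat_polys"
  using nested_bot_notin by (auto simp: mem_flat_polys)

lemma nested_supported_cong_0:
  assumes "Poly_Mapping.keys q \<subseteq> nested" "q \<approx>\<^sub>C 0"
  shows "q = 0"
proof (rule nested_independent[OF assms(1)])
  fix y :: "'a int_mpoly" assume "y \<in> flat_polys"
  then have "y * q \<approx>\<^sub>C y * 0" by (rule chow_cong_mult[OF assms(2)])
  from degf_cong[OF this] show "degf (q * y) = 0" by (simp add: mult.commute)
qed

text \<open>Spanning is straightening. For uniqueness, two coefficient families of one class give a
  difference that is supported on \<open>nested\<close> and lies in the ideal, hence is zero;
  injectivity of \<open>list_exponent\<close> recovers the coefficients.\<close>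

lemma int_basis_nested: "int_basis (aug_chow_ring TYPE('a)) (nested_data rk) chow_monomial"
proof -
  interpret A: cring "aug_chow_ring TYPE('a)" by (rule cring_aug_chow_ring)
  have mon_flat: "mon (list_exponent xs) \<in> flat_polys" if "xs \<in> nested_data rk" for xs
    using nested_data_exponent[OF that] nested_bot_notin by (intro flat_polys_mon) blast
  have comb: "(\<Oplus>\<^bsub>aug_chow_ring TYPE('a)\<^esub>xs\<in>Poly_Mapping.keys c. add_pow (aug_chow_ring TYPE('a)) (Poly_Mapping.lookup c xs) (chow_monomial xs))
      = chow_class (list_poly c)" if c: "Poly_Mapping.keys c \<subseteq> nested_data rk" for c
  proof -
    have "(\<Oplus>\<^bsub>aug_chow_ring TYPE('a)\<^esub>xs\<in>Poly_Mapping.keys c. add_pow (aug_chow_ring TYPE('a)) (Poly_Mapping.lookup c xs) (chow_monomial xs))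
      = (\<Oplus>\<^bsub>aug_chow_ring TYPE('a)\<^esub>xs\<in>Poly_Mapping.keys c. chow_class (of_int (Poly_Mapping.lookup c xs) * mon (list_exponent xs)))"
    proof (rule A.finsum_cong')
      show "add_pow (aug_chow_ring TYPE('a)) (Poly_Mapping.lookup c xs) (chow_monomial xs) =
          chow_class (of_int (Poly_Mapping.lookup c xs) * mon (list_exponent xs))" if "xs \<in> Poly_Mapping.keys c" for xs
        using that c mon_flat by (subst chow_monomial_eq) (auto intro!: chow_class_add_pow)
      show "(\<lambda>xs. chow_class (of_int (Poly_Mapping.lookup c xs) * mon (list_exponent xs))) \<in> Poly_Mapping.keys c \<rightarrow> carrier (aug_chow_ring TYPE('a))"
        using c mon_flat by (intro Pi_I chow_class_carrier flat_polys_mult flat_polys_of_int) blast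
    qed simp
    also have "\<dots> = chow_class (list_poly c)"
      unfolding list_poly_def single_of_int_mult[of _ "Poly_Mapping.lookup c _"]
      using c mon_flat by (intro chow_class_sum flat_polys_mult flat_polys_of_int) auto
    finally show ?thesis .
  qed
  have "\<exists>!c. Poly_Mapping.keys c \<subseteq> nested_data rk \<and> x = chow_class (list_poly c)"
    if x: "x \<in> carrier (aug_chow_ring TYPE('a))" for x
  proof -
    obtain p where p: "p \<in> flat_polys" "x = chow_class p" using x by (auto simp: carrier_aug_chow_ring)
    obtain q where q: "p \<approx>\<^sub>C q" "Poly_Mapping.keys q \<subseteq> nested" using straighten[OF p(1)] by blast
    have qf: "q \<in> flat_polys" by (rule nested_supported_flat_polys[OF q(2)])
    define idx where "idx = inv_into (nested_data rk) list_exponent"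
    have idx: "idx n \<in> nested_data rk" "list_exponent (idx n) = n" if "n \<in> nested" for n
    proof -
      have "n \<in> list_exponent ` nested_data rk" using nested_exponent_surj[OF that] by blast
      then show "idx n \<in> nested_data rk" "list_exponent (idx n) = n"
        by (simp_all add: idx_def inv_into_into f_inv_into_f)
    qed
    define c where "c = (\<Sum>n\<in>Poly_Mapping.keys q. Poly_Mapping.single (idx n) (Poly_Mapping.lookup q n))"
    have "Poly_Mapping.keys c \<subseteq> nested_data rk"
    proof
      fix xs assume "xs \<in> Poly_Mapping.keys c"
      then have "xs \<in> (\<Union>n\<in>Poly_Mapping.keys q. Poly_Mapping.keys (Poly_Mapping.single (idx n) (Poly_Mapping.lookup q n)))"
        unfolding c_def by (rule subsetD[OF keys_sum])
      then obtain n where "n \<in> Poly_Mapping.keys q" "xs = idx n" by (auto split: if_splits)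
      then show "xs \<in> nested_data rk" using idx(1) q(2) by auto
    qed
    moreover have "list_poly c = q"
    proof -
      have "list_poly c = (\<Sum>n\<in>Poly_Mapping.keys q. Poly_Mapping.single n (Poly_Mapping.lookup q n))"
        unfolding c_def list_poly_sum list_poly_single
        using idx(2) q(2) by (intro sum.cong refl arg_cong2[where f = Poly_Mapping.single]) auto
      also have "\<dots> = q" by (rule sum_monomials[symmetric])
      finally show ?thesis .
    qed
    moreover have "x = chow_class q" using p q(1) qf by (simp add: chow_class_eq_iff)
    ultimately have ex: "Poly_Mapping.keys c \<subseteq> nested_data rk" "x = chow_class (list_poly c)" by simp_all
    have uniq: "d = d'"
      if d: "Poly_Mapping.keys d \<subseteq> nested_data rk" "x = chow_class (list_poly d)"
        and d': "Poly_Mapping.keys d' \<subseteq> nested_data rk" "x = chow_class (list_poly d')" for d d'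
    proof -
      note kd = keys_list_poly[OF d(1)] and kd' = keys_list_poly[OF d'(1)]
      have "list_poly d \<approx>\<^sub>C list_poly d'"
        using d(2) d'(2) chow_class_eq_iff[OF nested_supported_flat_polys[OF kd] nested_supported_flat_polys[OF kd']] by simp
      then have "list_poly d - list_poly d' \<approx>\<^sub>C 0" by (simp add: chow_cong_def)
      moreover have "Poly_Mapping.keys (list_poly d - list_poly d') \<subseteq> nested"
        using order_trans[OF Poly_Mapping.keys_diff Un_least[OF kd kd']] .
      ultimately have "list_poly d - list_poly d' = 0" by (intro nested_supported_cong_0)
      then have eq: "list_poly d = list_poly d'" by simp
      have "Poly_Mapping.lookup d xs = Poly_Mapping.lookup d' xs" for xs
      proof (cases "xs \<in> nested_data rk")
        case True
        then show ?thesis using lookup_list_poly[OF d(1) True] lookup_list_poly[OF d'(1) True] eq by simp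
      next
        case False
        then have "xs \<notin> Poly_Mapping.keys d" "xs \<notin> Poly_Mapping.keys d'" using d(1) d'(1) by blast+
        then show ?thesis by (simp add: in_keys_iff)
      qed
      then show ?thesis by (rule poly_mapping_eqI)
    qed
    show ?thesis
    proof (rule ex1I)
      show "Poly_Mapping.keys c \<subseteq> nested_data rk \<and> x = chow_class (list_poly c)" using ex ..
      show "d = c" if "Poly_Mapping.keys d \<subseteq> nested_data rk \<and> x = chow_class (list_poly d)" for d
        using that ex by (intro uniq) simp_all
    qed
  qed
  moreover have "chow_monomial \<in> nested_data rk \<rightarrow> carrier (aug_chow_ring TYPE('a))"
    using mon_flat by (auto simp: chow_monomial_eq intro!: chow_class_carrier)
  ultimately show ?thesis
    unfolding int_basis_def by (auto simp: comb cong: conj_cong)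
qed


section \<open>The degree map on the ring\<close>

definition chow_deg :: "'a int_mpoly set \<Rightarrow> int" where
  "chow_deg x = degf (SOME p. p \<in> flat_polys \<and> chow_class p = x)"

text \<open>The representative picked by \<open>SOME\<close> is irrelevant because
  \<open>degf\<close> is constant on congruence classes.\<close>

lemma chow_deg_class:
  assumes "p \<in> flat_polys"
  shows "chow_deg (chow_class p) = degf p"
proof -
  define q where "q = (SOME q. q \<in> flat_polys \<and> chow_class q = chow_class p)"
  have "q \<in> flat_polys \<and> chow_class q = chow_class p"
    unfolding q_def by (rule someI[of _ p]) (simp add: assms)
  then have "q \<approx>\<^sub>C p" using chow_class_eq_iff[OF _ assms] by blast
  then show ?thesis unfolding chow_deg_def q_def[symmetric] by (rule degf_cong)
qed

lemma carrier_chow_part: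
  "carrier (chow_part TYPE('a) k) = {chow_class p | p. p \<in> flat_polys \<and> homogeneous k p}"
  by (simp add: chow_part_def chow_class_def)

lemma chow_part_mult:
  assumes "p \<in> flat_polys" "q \<in> flat_polys"
  shows "chow_class p \<otimes>\<^bsub>chow_part TYPE('a) k\<^esub> chow_class q = chow_class (p + q)"
  using chow_class_add[OF assms] by (simp add: chow_part_def)

text \<open>Straightening keeps the degree, so the nested form of p is supported in degree k, and
  the duals of its terms lie in the degree against which p is tested.\<close>

lemma homogeneous_cong_0:
  fixes p :: "'a int_mpoly"
  assumes p: "p \<in> flat_polys" "homogeneous k p"
    and zero: "\<And>y. y \<in> flat_polys \<Longrightarrow> homogeneous (int (rk Orderings.top) - k) y \<Longrightarrow> degf (p * y) = 0"
  shows "p \<approx>\<^sub>C 0"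
proof -
  obtain q where q: "p \<approx>\<^sub>C q" "Poly_Mapping.keys q \<subseteq> nested"
    "\<And>n. n \<in> Poly_Mapping.keys q \<Longrightarrow> \<exists>m\<in>Poly_Mapping.keys p. cum n Orderings.top = cum m Orderings.top"
    using straighten[OF p(1)] by blast
  have "q = 0"
  proof (rule nested_independent[OF q(2)])
    fix f and y :: "'a int_mpoly" assume f: "f \<in> Poly_Mapping.keys q" and y: "y \<in> flat_polys"
      "homogeneous (int (rk Orderings.top) - int (cum f Orderings.top)) y"
    have "int (cum f Orderings.top) = k" using q(3)[OF f] p(2) by (auto simp: homogeneous_iff)
    then have "degf (p * y) = 0" using zero y by simp
    moreover have "y * p \<approx>\<^sub>C y * q" by (rule chow_cong_mult[OF q(1) y(1)])
    ultimately show "degf (q * y) = 0" using degf_cong[of "y * p" "y * q"] by (simp add: mult.commute)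
  qed
  with q(1) show ?thesis by simp
qed

lemma homogeneous_0_const:
  assumes "homogeneous 0 (y :: 'a int_mpoly)"
  shows "y = of_int (Poly_Mapping.lookup y 0)"
proof -
  have "m = 0" if "m \<in> Poly_Mapping.keys y" for m
  proof -
    have "cum m Orderings.top = 0" using assms that by (simp add: homogeneous_iff)
    then show "m = 0" by (simp add: cum_eq_0_iff)
  qed
  then have "y = Poly_Mapping.single 0 (Poly_Mapping.lookup y 0)"
    by (intro poly_mapping_eqI) (auto simp: lookup_single when_def in_keys_iff)
  also have "\<dots> = of_int (Poly_Mapping.lookup y 0)" by (subst single_of_int_mult) simp
  finally show ?thesis .
qed

text \<open>Injectivity is nondegeneracy against degree 0, which consists of integers; surjectivity
  takes integer multiples of the dual of the empty monomial, on which \<open>degf\<close> is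
  1.\<close>

lemma chow_deg_iso: "chow_deg \<in> iso (chow_part TYPE('a) (int (rk Orderings.top))) integer_group"
proof -
  have "chow_deg (x \<otimes>\<^bsub>chow_part TYPE('a) (int (rk Orderings.top))\<^esub> y) = chow_deg x + chow_deg y"
    if "x \<in> carrier (chow_part TYPE('a) (int (rk Orderings.top)))" "y \<in> carrier (chow_part TYPE('a) (int (rk Orderings.top)))" for x y
    using that by (auto simp: carrier_chow_part chow_part_mult chow_deg_class degf_add)
  moreover have "inj_on chow_deg (carrier (chow_part TYPE('a) (int (rk Orderings.top))))"
  proof (rule inj_onI)
    fix x y assume "x \<in> carrier (chow_part TYPE('a) (int (rk Orderings.top)))"
      "y \<in> carrier (chow_part TYPE('a) (int (rk Orderings.top)))" and eq: "chow_deg x = chow_deg y"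
    then obtain p q where p: "p \<in> flat_polys" "homogeneous (int (rk Orderings.top)) p" "x = chow_class p"
      and q: "q \<in> flat_polys" "homogeneous (int (rk Orderings.top)) q" "y = chow_class q"
      by (auto simp: carrier_chow_part)
    have "degf (p - q) = 0" using eq p q by (simp add: chow_deg_class degf_diff)
    have zero: "degf ((p - q) * z) = 0" if "homogeneous 0 z" for z
    proof -
      have "(p - q) * z = of_int (Poly_Mapping.lookup z 0) * (p - q)"
        using homogeneous_0_const[OF that] by (metis mult.commute)
      then show ?thesis by (simp only: degf_of_int_mult \<open>degf (p - q) = 0\<close> mult_zero_right)
    qed
    then have "p - q \<approx>\<^sub>C 0"
      using p q zero by (intro homogeneous_cong_0[of _ "int (rk Orderings.top)"] homogeneous_diff) simp_all
    then show "x = y" using p q by (simp add: chow_class_eq_iff chow_cong_def)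
  qed
  moreover have "c \<in> chow_deg ` carrier (chow_part TYPE('a) (int (rk Orderings.top)))" for c
  proof -
    have "0 \<in> nested" by (simp add: nested_def)
    from exists_dual_polynomial[OF this] obtain y where y0: "y \<in> flat_polys"
      "homogeneous (int (rk Orderings.top) - int (cum (0 :: 'a \<Rightarrow>\<^sub>0 nat) Orderings.top)) y" "degf (mon 0 * y) = 1" by blast
    then have y: "y \<in> flat_polys" "homogeneous (int (rk Orderings.top)) y" "degf y = 1" by simp_all
    have "chow_deg (chow_class (of_int c * y)) = c"
      using y by (simp add: chow_deg_class degf_of_int_mult)
    moreover have "chow_class (of_int c * y) \<in> carrier (chow_part TYPE('a) (int (rk Orderings.top)))"
      using flat_polys_mult[OF flat_polys_of_int y(1)] homogeneous_of_int_mult[OF y(2)]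
      unfolding carrier_chow_part by blast
    ultimately show ?thesis by (intro image_eqI[of _ chow_deg "chow_class (of_int c * y)"]) simp_all
  qed
  then have "chow_deg ` carrier (chow_part TYPE('a) (int (rk Orderings.top))) = UNIV" by blast
  ultimately show ?thesis
    by (simp add: iso_def hom_def bij_betw_def)
qed

text \<open>Translates between the two forms of the Hall-Rado condition: a set T is tested at the
  join of its flats, and a flat H by the set of all i with \<open>F i\<close> below H. Counting
  indices accounts for repeated flats.\<close>

lemma chow_deg_prod:
  fixes F :: "nat \<Rightarrow> 'a"
  assumes "\<And>i. i \<in> {1..rk Orderings.top} \<Longrightarrow> F i \<noteq> bot"
  shows "chow_deg (\<Otimes>\<^bsub>aug_chow_ring TYPE('a)\<^esub>i\<in>{1..rk Orderings.top}. hcls (F i)) =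
    (if \<forall>T\<subseteq>{1..rk Orderings.top}. card T \<le> rk (SUP i\<in>T. F i) then 1 else 0)"
proof -
  define u where "u = (\<lambda>S. \<Sum>i\<in>S. Poly_Mapping.single (F i) (1::nat))"
  have prod: "(\<Prod>i\<in>S. mvar (F i)) = mon (u S)" if "finite S" for S
    using that by (induction S) (simp_all add: u_def mvar_def mult_single)
  have cum_u: "cum (u S) H = card {i \<in> S. F i \<le> H}" if "finite S" for S H
    using that
  proof (induction S)
    case (insert i S)
    have "{j \<in> insert i S. F j \<le> H} = (if F i \<le> H then insert i {j \<in> S. F j \<le> H} else {j \<in> S. F j \<le> H})" by auto
    then show ?case using insert by (simp add: u_def cum_add cum_single)
  qed (simp add: u_def)
  have "(\<Otimes>\<^bsub>aug_chow_ring TYPE('a)\<^esub>i\<in>{1..rk Orderings.top}. hcls (F i)) = chow_class (mon (u {1..rk Orderings.top}))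
      \<and> mon (u {1..rk Orderings.top}) \<in> flat_polys"
    using chow_class_prod[of "{1..rk Orderings.top}" "\<lambda>i. mvar (F i)"] assms by (simp add: hcls_eq prod)
  then have "chow_deg (\<Otimes>\<^bsub>aug_chow_ring TYPE('a)\<^esub>i\<in>{1..rk Orderings.top}. hcls (F i)) =
      (if u {1..rk Orderings.top} \<in> tops then 1 else 0)"
    by (simp add: chow_deg_class degf_single)
  moreover have "u {1..rk Orderings.top} \<in> tops \<longleftrightarrow> (\<forall>T\<subseteq>{1..rk Orderings.top}. card T \<le> rk (SUP i\<in>T. F i))"
  proof
    assume t: "u {1..rk Orderings.top} \<in> tops"
    show "\<forall>T\<subseteq>{1..rk Orderings.top}. card T \<le> rk (SUP i\<in>T. F i)"
    proof (intro allI impI)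
      fix T assume T: "T \<subseteq> {1..rk Orderings.top}"
      have "card T \<le> card {i \<in> {1..rk Orderings.top}. F i \<le> (SUP i\<in>T. F i)}"
        using T by (intro card_mono) (auto intro: SUP_upper)
      also have "\<dots> \<le> rk (SUP i\<in>T. F i)"
        using t cum_u[of "{1..rk Orderings.top}"] by (simp add: tops_def)
      finally show "card T \<le> rk (SUP i\<in>T. F i)" .
    qed
  next
    assume h: "\<forall>T\<subseteq>{1..rk Orderings.top}. card T \<le> rk (SUP i\<in>T. F i)"
    have "card {i \<in> {1..rk Orderings.top}. F i \<le> H} \<le> rk H" for H
    proof -
      have "card {i \<in> {1..rk Orderings.top}. F i \<le> H} \<le> rk (SUP i\<in>{i \<in> {1..rk Orderings.top}. F i \<le> H}. F i)"
        by (rule h[rule_format]) blast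
      also have "\<dots> \<le> rk H" by (intro rk_mono SUP_least) auto
      finally show ?thesis .
    qed
    moreover have "{i \<in> {1..rk Orderings.top}. F i \<le> Orderings.top} = {1..rk Orderings.top}" by auto
    then have "cum (u {1..rk Orderings.top}) Orderings.top = rk Orderings.top"
      by (simp only: cum_u finite_atLeastAtMost card_atLeastAtMost diff_Suc_1)
    ultimately show "u {1..rk Orderings.top} \<in> tops" by (simp add: tops_def cum_u)
  qed
  ultimately show ?thesis by simp
qed

section \<open>Unimodularity of the pairing\<close>

lemma additive_of_int_mult:
  fixes \<psi> :: "'a int_mpoly \<Rightarrow> int"
  assumes add: "\<And>p q. p \<in> S \<Longrightarrow> q \<in> S \<Longrightarrow> \<psi> (p + q) = \<psi> p + \<psi> q"
    and closed: "\<And>c q. q \<in> S \<Longrightarrow> of_int c * q \<in> S" and p: "p \<in> S"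
  shows "\<psi> (of_int c * p) = c * \<psi> p"
proof (induction c rule: int_induct[of _ 0])
  case base
  have "0 \<in> S" using closed[OF p, of 0] by simp
  with add[of 0 0] show ?case by simp
next
  case (step1 i)
  have "of_int (i + 1) * p = of_int i * p + p" by (simp add: algebra_simps)
  then show ?case using step1.IH add[OF closed[OF p, of i] p] by (simp add: algebra_simps del: of_int_add)
next
  case (step2 i)
  have "of_int i * p = of_int (i - 1) * p + p" by (simp add: algebra_simps)
  then show ?case using step2.IH add[OF closed[OF p, of "i - 1"] p] by (simp add: algebra_simps del: of_int_diff)
qed

text \<open>Injectivity is \<open>homogeneous_cong_0\<close>. For surjectivity, a homomorphism on
  degree r - k is matched on the nested monomials of that degree, which generate it by
  straightening. Degrees are integers, so k outside the range from 0 to r is covered by the same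
  argument.\<close>

lemma pairing_iso:
  "(\<lambda>a \<in> carrier (chow_part TYPE('a) k). \<lambda>b \<in> carrier (chow_part TYPE('a) (int (rk Orderings.top) - k)).
      chow_deg (a \<otimes>\<^bsub>aug_chow_ring TYPE('a)\<^esub> b))
    \<in> iso (chow_part TYPE('a) k) (Hom_group (chow_part TYPE('a) (int (rk Orderings.top) - k)) integer_group)"
proof -
  define j where "j = int (rk Orderings.top) - k"
  define \<Phi> where "\<Phi> = (\<lambda>a \<in> carrier (chow_part TYPE('a) k). \<lambda>b \<in> carrier (chow_part TYPE('a) j).
      chow_deg (a \<otimes>\<^bsub>aug_chow_ring TYPE('a)\<^esub> b))"
  have \<Phi>: "\<Phi> (chow_class p) (chow_class q) = degf (p * q)"
    if "p \<in> flat_polys" "homogeneous k p" "q \<in> flat_polys" "homogeneous j q" for p q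
  proof -
    have "chow_class p \<in> carrier (chow_part TYPE('a) k)" "chow_class q \<in> carrier (chow_part TYPE('a) j)"
      using that unfolding carrier_chow_part by blast+
    then show ?thesis using that by (simp add: \<Phi>_def chow_class_mult chow_deg_class)
  qed
  have \<Phi>_ext: "\<Phi> a \<in> extensional (carrier (chow_part TYPE('a) j))" if "a \<in> carrier (chow_part TYPE('a) k)" for a
    using that by (simp add: \<Phi>_def)
  have hom: "\<Phi> a \<in> carrier (Hom_group (chow_part TYPE('a) j) integer_group)"
    if a: "a \<in> carrier (chow_part TYPE('a) k)" for a
  proof -
    obtain p where p: "p \<in> flat_polys" "homogeneous k p" "a = chow_class p"
      using a by (auto simp: carrier_chow_part)
    have "\<Phi> a (x \<otimes>\<^bsub>chow_part TYPE('a) j\<^esub> y) = \<Phi> a x + \<Phi> a y"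
      if "x \<in> carrier (chow_part TYPE('a) j)" "y \<in> carrier (chow_part TYPE('a) j)" for x y
      using that p by (auto simp: carrier_chow_part chow_part_mult \<Phi> homogeneous_add degf_add distrib_left)
    then show ?thesis using \<Phi>_ext[OF a] by (simp add: Hom_group_def hom_def)
  qed
  have add: "\<Phi> (a \<otimes>\<^bsub>chow_part TYPE('a) k\<^esub> a') = \<Phi> a \<otimes>\<^bsub>Hom_group (chow_part TYPE('a) j) integer_group\<^esub> \<Phi> a'"
    if aa': "a \<in> carrier (chow_part TYPE('a) k)" "a' \<in> carrier (chow_part TYPE('a) k)" for a a'
  proof -
    obtain p p' where p: "p \<in> flat_polys" "homogeneous k p" "a = chow_class p"
      and p': "p' \<in> flat_polys" "homogeneous k p'" "a' = chow_class p'"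
      using aa' by (auto simp: carrier_chow_part)
    have aa: "a \<otimes>\<^bsub>chow_part TYPE('a) k\<^esub> a' = chow_class (p + p')" using p p' by (simp add: chow_part_mult)
    have mem: "chow_class (p + p') \<in> carrier (chow_part TYPE('a) k)"
      using p p' homogeneous_add unfolding carrier_chow_part by auto
    show ?thesis
      unfolding aa
    proof (rule extensionalityI[OF \<Phi>_ext[OF mem]])
      show "\<Phi> a \<otimes>\<^bsub>Hom_group (chow_part TYPE('a) j) integer_group\<^esub> \<Phi> a' \<in> extensional (carrier (chow_part TYPE('a) j))"
        by (simp add: Hom_group_def)
      fix b assume b: "b \<in> carrier (chow_part TYPE('a) j)"
      then obtain q where "q \<in> flat_polys" "homogeneous j q" "b = chow_class q" by (auto simp: carrier_chow_part)
      then show "\<Phi> (chow_class (p + p')) b = (\<Phi> a \<otimes>\<^bsub>Hom_group (chow_part TYPE('a) j) integer_group\<^esub> \<Phi> a') b"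
        using b p p' by (simp add: Hom_group_def \<Phi> homogeneous_add distrib_right degf_add)
    qed
  qed
  have inj: "inj_on \<Phi> (carrier (chow_part TYPE('a) k))"
  proof (rule inj_onI)
    fix a a' assume "a \<in> carrier (chow_part TYPE('a) k)" "a' \<in> carrier (chow_part TYPE('a) k)" and eq: "\<Phi> a = \<Phi> a'"
    then obtain p p' where p: "p \<in> flat_polys" "homogeneous k p" "a = chow_class p"
      and p': "p' \<in> flat_polys" "homogeneous k p'" "a' = chow_class p'"
      by (auto simp: carrier_chow_part)
    have "p - p' \<approx>\<^sub>C 0"
    proof (rule homogeneous_cong_0)
      show "p - p' \<in> flat_polys" "homogeneous k (p - p')" using p p' homogeneous_diff by auto
      fix y :: "'a int_mpoly" assume y: "y \<in> flat_polys" "homogeneous (int (rk Orderings.top) - k) y"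
      then show "degf ((p - p') * y) = 0"
        using fun_cong[OF eq, of "chow_class y"] p p'
        by (simp add: \<Phi> j_def left_diff_distrib degf_diff)
    qed
    then show "a = a'" using p p' by (simp add: chow_class_eq_iff chow_cong_def)
  qed
  have surj: "\<phi> \<in> \<Phi> ` carrier (chow_part TYPE('a) k)"
    if \<phi>: "\<phi> \<in> carrier (Hom_group (chow_part TYPE('a) j) integer_group)" for \<phi>
  proof -
    have \<phi>_ext: "\<phi> \<in> extensional (carrier (chow_part TYPE('a) j))"
      and \<phi>_add: "\<And>x y. x \<in> carrier (chow_part TYPE('a) j) \<Longrightarrow> y \<in> carrier (chow_part TYPE('a) j) \<Longrightarrow>
        \<phi> (x \<otimes>\<^bsub>chow_part TYPE('a) j\<^esub> y) = \<phi> x + \<phi> y"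
      using \<phi> by (auto simp: Hom_group_def hom_def)
    define S where "S = {p :: 'a int_mpoly. p \<in> flat_polys \<and> homogeneous j p}"
    define \<psi> where "\<psi> = (\<lambda>p. \<phi> (chow_class p))"
    have \<psi>_add: "\<psi> (p + q) = \<psi> p + \<psi> q" if "p \<in> S" "q \<in> S" for p q
    proof -
      have "chow_class p \<in> carrier (chow_part TYPE('a) j)" "chow_class q \<in> carrier (chow_part TYPE('a) j)"
        using that unfolding carrier_chow_part S_def by blast+
      from \<phi>_add[OF this] that show ?thesis by (simp add: \<psi>_def S_def chow_part_mult)
    qed
    have S_mult: "of_int c * q \<in> S" if "q \<in> S" for c q
      using that homogeneous_of_int_mult by (simp add: S_def)
    have S_0: "0 \<in> S" by (simp add: S_def homogeneous_0)
    have S_add: "p + q \<in> S" if "p \<in> S" "q \<in> S" for p q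
      using that homogeneous_add by (simp add: S_def)
    define N where "N = {n \<in> nested. int (cum n Orderings.top) = j}"
    have "finite N" using finite_nested by (simp add: N_def)
    moreover have "n \<in> nested \<and> int (cum n Orderings.top) = j" if "n \<in> N" for n
      using that by (simp add: N_def)
    ultimately have "\<exists>x\<in>flat_polys. homogeneous (int (rk Orderings.top) - j) x \<and> (\<forall>n\<in>N. degf (mon n * x) = \<psi> (mon n))"
      by (rule exists_prescribed_degf)
    then obtain x where x: "x \<in> flat_polys" "homogeneous k x" "\<And>n. n \<in> N \<Longrightarrow> degf (mon n * x) = \<psi> (mon n)"
      by (auto simp: j_def)
    have xk: "chow_class x \<in> carrier (chow_part TYPE('a) k)" using x unfolding carrier_chow_part by blast
    have "\<Phi> (chow_class x) = \<phi>"
    proof (rule extensionalityI[OF \<Phi>_ext[OF xk] \<phi>_ext])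
      fix b assume "b \<in> carrier (chow_part TYPE('a) j)"
      then obtain p where p: "p \<in> flat_polys" "homogeneous j p" "b = chow_class p" by (auto simp: carrier_chow_part)
      obtain q where q: "p \<approx>\<^sub>C q" "Poly_Mapping.keys q \<subseteq> nested"
        "\<And>n. n \<in> Poly_Mapping.keys q \<Longrightarrow> \<exists>m\<in>Poly_Mapping.keys p. cum n Orderings.top = cum m Orderings.top"
        using straighten[OF p(1)] by blast
      have qN: "n \<in> N" if "n \<in> Poly_Mapping.keys q" for n
        using q(2,3) that p(2) by (force simp: N_def homogeneous_iff)
      have monS: "mon n \<in> S" if "n \<in> N" for n
        using that nested_bot_notin[of n] by (auto simp: S_def N_def homogeneous_iff)
      have lin: "\<psi> (\<Sum>n\<in>M. of_int (c n) * mon n) = (\<Sum>n\<in>M. c n * \<psi> (mon n)) \<and> (\<Sum>n\<in>M. of_int (c n) * mon n) \<in> S"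
        if "finite M" "M \<subseteq> N" for M c
        using that
      proof (induction M)
        case empty
        show ?case using \<psi>_add[OF S_0 S_0] S_0 by simp
      next
        case (insert n M)
        then have n: "mon n \<in> S" by (intro monS) simp
        show ?case
          using insert n \<psi>_add[OF S_mult[OF n]] S_add[OF S_mult[OF n]]
            additive_of_int_mult[of S \<psi>, OF \<psi>_add S_mult n] by simp
      qed
      have "q = (\<Sum>n\<in>Poly_Mapping.keys q. of_int (Poly_Mapping.lookup q n) * mon n)"
        unfolding single_of_int_mult[symmetric] by (rule sum_monomials)
      then have "\<psi> q = \<psi> (\<Sum>n\<in>Poly_Mapping.keys q. of_int (Poly_Mapping.lookup q n) * mon n)"
        by (rule arg_cong)
      also have "\<dots> = (\<Sum>n\<in>Poly_Mapping.keys q. Poly_Mapping.lookup q n * \<psi> (mon n))"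
        using qN by (intro conjunct1[OF lin]) auto
      also have "\<dots> = degf (q * x)"
        unfolding degf_mult[of q x] using x(3) qN by (intro sum.cong) auto
      also have "\<dots> = degf (x * p)"
        using degf_cong[OF chow_cong_mult[OF q(1) x(1)]] by (simp add: mult.commute)
      also have "\<dots> = \<Phi> (chow_class x) b" using x p by (simp add: \<Phi>)
      finally have "\<psi> q = \<Phi> (chow_class x) b" .
      moreover have "chow_class p = chow_class q"
        using chow_class_eq_iff[OF p(1) nested_supported_flat_polys[OF q(2)]] q(1) by simp
      ultimately show "\<Phi> (chow_class x) b = \<phi> b" by (simp add: \<psi>_def p(3))
    qed
    with xk show ?thesis by blast
  qed
  have "\<Phi> \<in> iso (chow_part TYPE('a) k) (Hom_group (chow_part TYPE('a) j) integer_group)"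
    unfolding iso_def bij_betw_def hom_def[of "chow_part TYPE('a) k"]
  proof (intro CollectI conjI ballI Pi_I)
    show "\<Phi> ` carrier (chow_part TYPE('a) k) = carrier (Hom_group (chow_part TYPE('a) j) integer_group)"
      using hom surj by blast
  qed (use hom add inj in simp_all)
  then show ?thesis by (simp add: \<Phi>_def j_def)
qed

end

theorem theorem1p4:
  fixes rk :: "'a::{finite,complete_lattice} \<Rightarrow> nat" and r :: nat
  assumes "matroid_lattice rk" and "r = rk Orderings.top"
  shows "int_basis (aug_chow_ring TYPE('a)) (nested_data rk) chow_monomial \<and>
    (\<exists>deg \<in> iso (chow_part TYPE('a) (int r)) integer_group.
      (\<forall>F :: nat \<Rightarrow> 'a. (\<forall>i\<in>{1..r}. F i \<noteq> bot) \<longrightarrow>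
        deg (\<Otimes>\<^bsub>aug_chow_ring TYPE('a)\<^esub>i\<in>{1..r}. hcls (F i)) =
          (if \<forall>T\<subseteq>{1..r}. card T \<le> rk (SUP i\<in>T. F i) then 1 else 0)) \<and>
      (\<forall>k :: int.
        (\<lambda>a \<in> carrier (chow_part TYPE('a) k). \<lambda>b \<in> carrier (chow_part TYPE('a) (int r - k)).
            deg (a \<otimes>\<^bsub>aug_chow_ring TYPE('a)\<^esub> b))
        \<in> iso (chow_part TYPE('a) k)
              (Hom_group (chow_part TYPE('a) (int r - k)) integer_group)))"
proof -
  interpret matroid_lattice rk by fact
  show ?thesis
    unfolding assms(2)
    using int_basis_nested chow_deg_iso chow_deg_prod pairing_iso
    by (intro conjI bexI[of _ chow_deg] allI impI) auto
qed

end
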